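(* Every finite $2$-connected graph $G$ has the strong $\mathcal{F}_3$ property: for any three distinct vertices $x_1, x_2, x_3$ of $G$ and any given $i \in \{1,2\}$, there is a hamiltonian path in $G^2$ from $x_1$ to $x_2$ which contains two distinct edges $x_3z_3$ and $x_iz_i$ of $G$ (for some $z_3, z_i \in V(G)$).
   Context: All graphs are finite and simple. The square $G^2$ of $G$ is the graph on $V(G)$ in which two distinct vertices are adjacent iff their distance in $G$ is at most $2$; thus $E(G)\subseteq E(G^2)$. *)

theory Defs
  imports "Graph_Theory.Graph_Theory"
begin

text \<open>
  A finite simple graph is a \<^locale>\<open>pair_graph\<close>: a finite, loop-free, symmetric set of arcs,
  in which an undirected edge \<open>uv\<close> is the pair of arcs \<open>(u, v)\<close> and \<open>(v, u)\<close>.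
\<close>

definition k_connected :: "nat \<Rightarrow> 'a pair_pre_digraph \<Rightarrow> bool" where
  "k_connected k G \<longleftrightarrow>
     k < card (pverts G) \<and>
     (\<forall>X \<subseteq> pverts G. card X < k \<longrightarrow>
        Digraph_Component.connected (with_proj G \<restriction> (pverts G - X)))"

text \<open>With unit arc weights, \<^const>\<open>wf_digraph.\<mu>\<close> is the usual graph distance (infinite if
  there is no walk).\<close>

definition graph_dist :: "'a pair_pre_digraph \<Rightarrow> 'a \<Rightarrow> 'a \<Rightarrow> ereal" where
  "graph_dist G u v = wf_digraph.\<mu> (with_proj G) (\<lambda>_. 1) u v"

definition square :: "'a pair_pre_digraph \<Rightarrow> 'a pair_pre_digraph" where
  "square G =
     \<lparr> pverts = pverts G,
       parcs = {(u, v). u \<in> pverts G \<and> v \<in> pverts G \<and> u \<noteq> v \<and> graph_dist G u v \<le> 2} \<rparr>"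

definition hamiltonian_path ::
    "'a pair_pre_digraph \<Rightarrow> 'a \<Rightarrow> ('a \<times> 'a) awalk \<Rightarrow> 'a \<Rightarrow> bool" where
  "hamiltonian_path G u p v \<longleftrightarrow>
     pre_digraph.apath (with_proj G) u p v \<and>
     set (pre_digraph.awalk_verts (with_proj G) u p) = pverts G"

text \<open>The undirected edges traversed by a walk, forgetting the direction of traversal.\<close>

definition path_edges :: "('a \<times> 'a) awalk \<Rightarrow> 'a set set" where
  "path_edges p = (\<lambda>(u, v). {u, v}) ` set p"

definition strong_F3 :: "'a pair_pre_digraph \<Rightarrow> bool" where
  "strong_F3 G \<longleftrightarrow>
     (\<forall>x :: nat \<Rightarrow> 'a. x ` {1, 2, 3} \<subseteq> pverts G \<and> inj_on x {1, 2, 3} \<longrightarrow>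
       (\<forall>i \<in> {1, 2}. \<exists>p z3 zi.
          hamiltonian_path (square G) (x 1) p (x 2) \<and>
          (x 3, z3) \<in> parcs G \<and> (x i, zi) \<in> parcs G \<and>
          {x 3, z3} \<noteq> {x i, zi} \<and>
          {x 3, z3} \<in> path_edges p \<and> {x i, zi} \<in> path_edges p))"

end

theory Submission
  imports Defs "HOL-Library.Multiset" "HOL-Library.Sublist"
begin

text \<open>
  Write \<open>S = {x\<^sub>i}\<close> and let \<open>z\<close> be the other one of \<open>x\<^sub>1, x\<^sub>2\<close>. The theorem follows from a
  statement about a vertex set \<open>W\<close> attached to \<open>S\<close> and \<open>z\<close> (\<open>route_with_edge\<close>): after the deletion of
  any vertex \<open>c\<close>, every remaining vertex of \<open>W\<close> still reaches \<open>z\<close> or a neighbour of \<open>S\<close>; then \<open>W\<close> can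
  be listed from a neighbour of \<open>S\<close> to \<open>z\<close>, with consecutive vertices at distance at most 2 or both
  adjacent to \<open>S\<close>, and with an edge of the graph at a prescribed vertex \<open>t\<close>. The induction on
  \<open>card W\<close> either splits \<open>W\<close> at \<open>t\<close> and a neighbour of \<open>t\<close>, or removes a path \<open>q\<^sub>1, \<dots>, q\<^sub>m = z\<close> that
  misses \<open>t\<close> and a neighbour of it. In the latter case the lists of the components of the rest are
  broken into pieces running between neighbourhoods of path vertices. The pieces are the edges of a
  multigraph on the labels \<open>0, \<dots>, m + 1\<close>, where \<open>0\<close> stands for \<open>S\<close>; each \<open>q\<^sub>k\<close> is one more edge, whose
  ends may be chosen among \<open>k - 1, k, k + 1\<close>. The choice is made such that the multigraph has an Euler
  trail, and the pieces are concatenated along it.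
\<close>

section \<open>Pieces and Euler trails\<close>

text \<open>Removing a path destroys 2-connectedness, so the induction needs a property that the
  remaining components inherit. Anchoring is one: a component of the rest is anchored to
  \<open>S\<close> together with the path, and \<open>S\<close> may be any set because it enters
  only through \<open>nb S\<close>. The price is that a list found by induction may jump between
  neighbours of two different members of the enlarged set. These jumps are exactly where lists are
  broken; the Euler trail repairs them, because vertices with a common label are pairwise linked. An
  edge of the graph is never such a jump, so the edge at \<open>t\<close> survives. The
  \<open>m\<close> path vertices must tie together \<open>m + 2\<close> labels and also correct all
  parities. Local choices settle all inner labels but one, and the handshake lemma settles that one.
  The path must miss a neighbour of \<open>t\<close> as well as \<open>t\<close>, because otherwise
  the component of \<open>t\<close> could be \<open>t\<close> alone and offer no edge. If no such
  path exists, then \<open>t\<close> cuts \<open>z\<close> off from the other neighbours of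
  \<open>S\<close>, or \<open>z\<close> is the only neighbour of \<open>t\<close> in
  \<open>W\<close>, or every other neighbour of \<open>t\<close> is a bottleneck between
  \<open>S\<close> and \<open>z\<close> once \<open>t\<close> is deleted.\<close>

text \<open>A piece \<open>(i, xs, j)\<close> is an edge between the labels \<open>i\<close> and \<open>j\<close> that carries the list \<open>xs\<close>;
  traversing it backwards reverses the list.\<close>

type_synonym 'a piece = "nat \<times> 'a list \<times> nat"

definition flip :: "'a piece \<Rightarrow> 'a piece" where
  "flip p = (snd (snd p), rev (fst (snd p)), fst p)"

definition unoriented :: "'a piece \<Rightarrow> 'a piece set" where
  "unoriented p = {p, flip p}"

text \<open>Pieces may be reversed individually, because an Euler trail decides the direction in
  which it traverses each of them.\<close>

definition reoriented :: "'a piece multiset \<Rightarrow> 'a piece multiset \<Rightarrow> bool" where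
  "reoriented M M' \<longleftrightarrow> image_mset unoriented M = image_mset unoriented M'"

definition deg :: "nat \<Rightarrow> 'a piece multiset \<Rightarrow> nat" where
  "deg l M = (\<Sum>p\<in>#M. of_bool (fst p = l) + of_bool (snd (snd p) = l))"

definition content :: "'a piece multiset \<Rightarrow> 'a multiset" where
  "content M = (\<Sum>p\<in>#M. mset (fst (snd p)))"

definition closed_under :: "'a piece multiset \<Rightarrow> nat set \<Rightarrow> bool" where
  "closed_under M X \<longleftrightarrow> (\<forall>p\<in>#M. fst p \<in> X \<longleftrightarrow> snd (snd p) \<in> X)"

text \<open>Connectedness up to isolated labels, phrased through cuts instead of walks: in this form
  a handshake parity can refute a separation directly.\<close>

definition linked :: "'a piece multiset \<Rightarrow> bool" where
  "linked M \<longleftrightarrow> (\<forall>X. closed_under M X \<longrightarrow> (\<forall>p\<in>#M. fst p \<in> X) \<or> (\<forall>p\<in>#M. fst p \<notin> X))"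

fun trail :: "nat \<Rightarrow> 'a piece list \<Rightarrow> nat \<Rightarrow> bool" where
  "trail a [] b \<longleftrightarrow> a = b"
| "trail a (p # ps) b \<longleftrightarrow> fst p = a \<and> trail (snd (snd p)) ps b"

lemma flip_flip [simp]: "flip (flip p) = p"
  by (simp add: flip_def)

lemma flip_sel [simp]: "fst (flip p) = snd (snd p)" "snd (snd (flip p)) = fst p"
  "fst (snd (flip p)) = rev (fst (snd p))"
  by (simp_all add: flip_def)

lemma unoriented_flip [simp]: "unoriented (flip p) = unoriented p"
  by (auto simp: unoriented_def)

lemma unoriented_eqD: "unoriented p = unoriented q \<Longrightarrow> q = p \<or> q = flip p"
  by (auto simp: unoriented_def doubleton_eq_iff)

lemma deg_simps [simp]:
  "deg l {#} = 0"
  "deg l (add_mset p M) = of_bool (fst p = l) + of_bool (snd (snd p) = l) + deg l M"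
  "deg l (M + M') = deg l M + deg l M'"
  by (simp_all add: deg_def)

lemma content_simps [simp]:
  "content {#} = {#}"
  "content (add_mset p M) = mset (fst (snd p)) + content M"
  "content (M + M') = content M + content M'"
  by (simp_all add: content_def)

lemma deg_eq_0_iff: "deg l M = 0 \<longleftrightarrow> (\<forall>p\<in>#M. fst p \<noteq> l \<and> snd (snd p) \<noteq> l)"
  by (induction M) auto

lemma closed_under_add_mset [simp]:
  "closed_under (add_mset p M) X \<longleftrightarrow> (fst p \<in> X \<longleftrightarrow> snd (snd p) \<in> X) \<and> closed_under M X"
  by (auto simp: closed_under_def)

lemma closed_under_union [simp]:
  "closed_under (M + M') X \<longleftrightarrow> closed_under M X \<and> closed_under M' X"
  by (auto simp: closed_under_def)

lemma closed_underD: "closed_under M X \<Longrightarrow> p \<in># M \<Longrightarrow> fst p \<in> X \<longleftrightarrow> snd (snd p) \<in> X"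
  by (auto simp: closed_under_def)

lemma closed_under_Compl: "closed_under M X \<Longrightarrow> closed_under M (- X)"
  by (auto simp: closed_under_def)

lemma reoriented_refl [simp]: "reoriented M M"
  by (simp add: reoriented_def)

lemma reoriented_sym: "reoriented M M' \<Longrightarrow> reoriented M' M"
  by (simp add: reoriented_def)

lemma reoriented_add_mset_left:
  assumes "reoriented (add_mset p M) M'"
  obtains q M'' where "M' = add_mset q M''" "q = p \<or> q = flip p" "reoriented M M''"
proof -
  have "unoriented p \<in># image_mset unoriented M'"
    using assms by (metis image_mset_add_mset reoriented_def union_single_eq_member)
  then obtain q where q: "q \<in># M'" "unoriented p = unoriented q"
    by auto
  then obtain M'' where "M' = add_mset q M''"
    by (metis insert_DiffM)
  moreover from this have "reoriented M M''"
    using assms q by (simp add: reoriented_def)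
  ultimately show ?thesis
    using that unoriented_eqD[OF q(2)] by blast
qed

lemma reoriented_set:
  assumes "reoriented M M'" "p \<in># M"
  shows "p \<in># M' \<or> flip p \<in># M'"
  using assms by (metis insert_DiffM reoriented_add_mset_left union_single_eq_member)

lemma reoriented_deg: "reoriented M M' \<Longrightarrow> deg l M' = deg l M"
proof (induction M arbitrary: M')
  case empty
  then show ?case by (simp add: reoriented_def)
next
  case (add p M)
  from add.prems obtain q M'' where "M' = add_mset q M''" "q = p \<or> q = flip p" "reoriented M M''"
    by (rule reoriented_add_mset_left)
  then show ?case using add.IH[of M''] by (elim disjE) (simp_all add: add.commute)
qed

lemma reoriented_cont: "reoriented M M' \<Longrightarrow> content M' = content M"
proof (induction M arbitrary: M')
  case empty
  then show ?case by (simp add: reoriented_def)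
next
  case (add p M)
  from add.prems obtain q M'' where "M' = add_mset q M''" "q = p \<or> q = flip p" "reoriented M M''"
    by (rule reoriented_add_mset_left)
  then show ?case using add.IH[of M''] by auto
qed

lemma reoriented_size: "reoriented M M' \<Longrightarrow> size M' = size M"
  by (metis reoriented_def size_image_mset)

section \<open>Trails and Euler's theorem for multigraphs of pieces\<close>

lemma trail_append: "trail a (ps @ qs) b \<longleftrightarrow> (\<exists>c. trail a ps c \<and> trail c qs b)"
  by (induction ps arbitrary: a) auto

lemma trail_rev: "trail a ps b \<Longrightarrow> trail b (rev (map flip ps)) a"
  by (induction ps arbitrary: a) (auto simp: trail_append)

text \<open>Every passage through a label uses two piece ends; only the start and the end of the
  trail leave one end unmatched.\<close>

lemma trail_parity: "trail a ps b \<Longrightarrow> even (deg l (mset ps) + of_bool (l = a) + of_bool (l = b))"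
proof (induction ps arbitrary: a)
  case (Cons p ps)
  then show ?case
    using Cons.IH[of "snd (snd p)"] by (cases "l = a"; cases "l = snd (snd p)") auto
qed auto

lemma trail_split:
  assumes "trail a ps b" "p \<in> set ps" "l = fst p \<or> l = snd (snd p)"
  obtains us vs where "ps = us @ vs" "trail a us l" "trail l vs b"
proof -
  obtain us vs where ps: "ps = us @ p # vs"
    using assms(2) by (meson split_list)
  have *: "trail a us (fst p)" "trail (snd (snd p)) vs b"
    using assms(1) by (auto simp: ps trail_append)
  show ?thesis
  proof (cases "l = fst p")
    case True
    then show ?thesis using that[of us "p # vs"] * ps by auto
  next
    case False
    then show ?thesis using that[of "us @ [p]" vs] * ps assms(3) by (auto simp: trail_append)
  qed
qed

text \<open>A longest trail is closed, because an open one can be prolonged by parity; if it missed a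
  piece, it could be rotated to start at a label of a missed piece and then be prolonged.\<close>

lemma Euler_closed:
  fixes M :: "'a piece multiset"
  assumes even_deg: "\<And>l. even (deg l M)" and "linked M" and "M \<noteq> {#}"
  obtains a qs where "trail a qs a" "reoriented M (mset qs)"
proof -
  \<comment> \<open>\<open>R\<close> collects the pieces that the trail misses. The length is
    bounded by \<open>size M\<close>, so a longest trail exists.\<close>
  define P where "P n \<longleftrightarrow> (\<exists>a b qs R. trail a qs b \<and> reoriented M (mset qs + R) \<and> length qs = n)" for n
  have "P 0"
    unfolding P_def using reoriented_refl[of M] by (metis list.size(3) mset.simps(1) trail.simps(1) add_0)
  moreover have bound: "n \<le> size M" if "P n" for n
    using that reoriented_size by (fastforce simp: P_def)
  ultimately obtain n where n: "P n" and max: "\<And>k. P k \<Longrightarrow> k \<le> n"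
    by (metis GreatestI_nat Greatest_le_nat)
  then obtain a b qs R where qs: "trail a qs b" "reoriented M (mset qs + R)" "length qs = n"
    by (auto simp: P_def)
  have no_ext: False
    if "trail a' qs' l" "reoriented M (mset qs' + R)" "length qs' = n" "p \<in># R"
      "l = fst p \<or> l = snd (snd p)" for a' qs' l p
  proof -
    define p' where "p' = (if l = fst p then p else flip p)"
    have "trail a' (qs' @ [p']) (snd (snd p'))"
      using that by (auto simp: trail_append p'_def)
    moreover have "reoriented M (mset (qs' @ [p']) + (R - {#p#}))"
      using that(2,4) by (auto simp: reoriented_def p'_def dest!: multi_member_split)
    ultimately have "P (Suc n)"
      unfolding P_def using that(3) by (metis length_append_singleton)
    then show False using max by fastforce
  qed
  have "a = b"
  proof (rule ccontr)
    assume "a \<noteq> b"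
    then have "odd (deg b (mset qs))"
      using trail_parity[OF qs(1), of b] by auto
    moreover have "even (deg b (mset qs) + deg b R)"
      using even_deg[of b] reoriented_deg[OF qs(2), of b] by simp
    ultimately have "odd (deg b R)" by simp
    then have "deg b R \<noteq> 0" by (metis even_zero)
    then show False using no_ext[OF qs] by (auto simp: deg_eq_0_iff)
  qed
  have "R = {#}"
  proof (rule ccontr)
    assume "R \<noteq> {#}"
    then obtain p0 where p0: "p0 \<in># R" by auto
    have "qs \<noteq> []"
      using no_ext[of "fst p0" "[]" "fst p0" p0] qs p0 by auto
    \<comment> \<open>The labels met by the trail. If no missed piece touched them, they would form
      a cut with \<open>hd qs\<close> on one side and \<open>p0\<close> on the other, against
      \<open>linked M\<close>.\<close>
    define X where "X = fst ` set qs \<union> (snd \<circ> snd) ` set qs"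
    have "\<exists>p\<in>#R. fst p \<in> X \<or> snd (snd p) \<in> X"
    proof (rule ccontr)
      assume neg: "\<not> ?thesis"
      have mem: "p \<in># mset qs + R \<or> flip p \<in># mset qs + R" if "p \<in># M" for p
        using that reoriented_set[OF qs(2)] by blast
      have cl: "closed_under M X"
        unfolding closed_under_def
      proof
        fix p assume "p \<in># M"
        from mem[OF this] have "(p \<in> set qs \<or> flip p \<in> set qs) \<or> (p \<in># R \<or> flip p \<in># R)"
          by auto
        then show "(fst p \<in> X) = (snd (snd p) \<in> X)"
        proof
          assume "p \<in> set qs \<or> flip p \<in> set qs"
          then show ?thesis by (force simp: X_def)
        next
          assume "p \<in># R \<or> flip p \<in># R"
          then show ?thesis using neg by force
        qed
      qed
      have R0: "p0 \<in># M \<or> flip p0 \<in># M"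
        using reoriented_set[OF reoriented_sym[OF qs(2)]] p0 by auto
      have "hd qs \<in># M \<or> flip (hd qs) \<in># M"
        using reoriented_set[OF reoriented_sym[OF qs(2)]] \<open>qs \<noteq> []\<close> by auto
      moreover have "fst (hd qs) \<in> X" "snd (snd (hd qs)) \<in> X"
        using \<open>qs \<noteq> []\<close> by (auto simp: X_def)
      ultimately have "\<forall>p\<in>#M. fst p \<in> X"
        using cl \<open>linked M\<close> unfolding linked_def by (metis flip_sel(1))
      then show False
        using R0 neg p0 by fastforce
    qed
    then obtain p l where p: "p \<in># R" "l = fst p \<or> l = snd (snd p)" "l \<in> X"
      by blast
    from p(3) obtain q where "q \<in> set qs" "l = fst q \<or> l = snd (snd q)"
      by (auto simp: X_def)
    with qs(1) obtain us vs where "qs = us @ vs" "trail a us l" "trail l vs b"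
      by (rule trail_split)
    then have "trail l (vs @ us) l" "reoriented M (mset (vs @ us) + R)" "length (vs @ us) = n"
      using \<open>a = b\<close> qs by (auto simp: trail_append add.commute)
    from no_ext[OF this p(1,2)] show False .
  qed
  then show ?thesis
    using that qs \<open>a = b\<close> by simp
qed

text \<open>A dummy piece from \<open>b\<close> to \<open>a\<close> with an empty list makes all
  degrees even. The closed trail is opened at the dummy, and reversed if the dummy was traversed
  backwards.\<close>

lemma Euler_open:
  fixes M :: "'a piece multiset"
  assumes even_deg: "\<And>l. l \<noteq> a \<Longrightarrow> l \<noteq> b \<Longrightarrow> even (deg l M)"
    and odd_deg: "odd (deg a M)" "odd (deg b M)" and "linked M" and "a \<noteq> b"
  obtains qs where "trail a qs b" "reoriented M (mset qs)"
proof -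
  define d :: "'a piece" where "d = (b, [], a)"
  have "even (deg l (add_mset d M))" for l
    using even_deg[of l] odd_deg \<open>a \<noteq> b\<close> by (auto simp: d_def)
  moreover have "linked (add_mset d M)"
    unfolding linked_def
  proof (intro allI impI)
    fix X assume X: "closed_under (add_mset d M) X"
    have "deg a M \<noteq> 0"
      using odd_deg by (metis even_zero)
    then obtain p where p: "p \<in># M" "a = fst p \<or> a = snd (snd p)"
      unfolding deg_eq_0_iff by blast
    have "fst p \<in> X \<longleftrightarrow> b \<in> X"
      using X p by (auto simp: d_def closed_under_def)
    moreover have "(\<forall>p\<in>#M. fst p \<in> X) \<or> (\<forall>p\<in>#M. fst p \<notin> X)"
      using X \<open>linked M\<close> by (auto simp: linked_def)
    ultimately show "(\<forall>p\<in>#add_mset d M. fst p \<in> X) \<or> (\<forall>p\<in>#add_mset d M. fst p \<notin> X)"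
      using p by (auto simp: d_def)
  qed
  ultimately obtain c qs where qs: "trail c qs c" "reoriented (add_mset d M) (mset qs)"
    using Euler_closed by (metis add_mset_not_empty)
  obtain q Q where q: "mset qs = add_mset q Q" "q = d \<or> q = flip d" "reoriented M Q"
    using qs(2) by (rule reoriented_add_mset_left)
  then obtain us vs where uv: "qs = us @ q # vs"
    by (metis ex_mset in_set_conv_decomp set_mset_mset union_single_eq_member)
  have Q: "Q = mset (vs @ us)"
    using q(1) by (simp add: uv add.commute)
  have t: "trail (snd (snd q)) (vs @ us) (fst q)"
    using qs(1) by (auto simp: uv trail_append)
  show ?thesis
  proof (cases "q = d")
    case True
    then show ?thesis using that t q(3) Q by (simp add: d_def)
  next
    case False
    then have "trail b (vs @ us) a"
      using t q(2) by (simp add: d_def)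
    from trail_rev[OF this] have "trail a (rev (map flip (vs @ us))) b" .
    moreover have "reoriented M (mset (rev (map flip (vs @ us))))"
      using q(3) by (simp add: Q reoriented_def image_mset.compositionality comp_def)
    ultimately show ?thesis using that by blast
  qed
qed

text \<open>A closed trail has no distinguished start, so it can be rotated to \<open>a\<close> and
  then cut at \<open>b\<close>. This serves the case of two end labels of even degree.\<close>

lemma Euler_closed_through:
  fixes M :: "'a piece multiset"
  assumes "\<And>l. even (deg l M)" and "linked M" and "deg a M \<noteq> 0" "deg b M \<noteq> 0" and "a \<noteq> b"
  obtains us vs where "trail a us b" "trail b vs a" "reoriented M (mset us + mset vs)"
proof -
  have "M \<noteq> {#}" using assms(3) by auto
  then obtain c qs where qs: "trail c qs c" "reoriented M (mset qs)"
    using Euler_closed assms(1,2) by metis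
  have "deg a (mset qs) \<noteq> 0" "deg b (mset qs) \<noteq> 0"
    using assms(3,4) reoriented_deg[OF qs(2)] by auto
  then obtain p q where pq: "p \<in> set qs" "a = fst p \<or> a = snd (snd p)"
      "q \<in> set qs" "b = fst q \<or> b = snd (snd q)"
    unfolding deg_eq_0_iff by auto
  obtain us vs where 1: "qs = us @ vs" "trail c us a" "trail a vs c"
    using qs(1) pq(1,2) by (rule trail_split)
  then have "trail a (vs @ us) a" "q \<in> set (vs @ us)"
    using pq(3) by (auto simp: trail_append)
  from trail_split[OF this pq(4)] obtain us' vs' where
    "vs @ us = us' @ vs'" "trail a us' b" "trail b vs' a" .
  moreover from this have "mset qs = mset us' + mset vs'"
    using 1(1) by (metis mset_append union_commute)
  ultimately show ?thesis using that qs(2) by metis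
qed

section \<open>Choosing the labels of the path vertices\<close>

definition labels_le :: "nat \<Rightarrow> 'a piece multiset \<Rightarrow> bool" where
  "labels_le n M \<longleftrightarrow> (\<forall>p\<in>#M. fst p \<le> n \<and> snd (snd p) \<le> n)"

lemma labels_le_simps [simp]:
  "labels_le n {#}"
  "labels_le n (add_mset p M) \<longleftrightarrow> fst p \<le> n \<and> snd (snd p) \<le> n \<and> labels_le n M"
  "labels_le n (M + M') \<longleftrightarrow> labels_le n M \<and> labels_le n M'"
  by (auto simp: labels_le_def)

section \<open>Handshake parities and connectedness by cuts\<close>

lemma labels_le_deg: "labels_le n M \<Longrightarrow> n < l \<Longrightarrow> deg l M = 0"
  unfolding labels_le_def deg_eq_0_iff using leD by blast

text \<open>Handshake lemma on one side of a cut: no piece crosses, so each contributes 0 or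
  2.\<close>

lemma even_sum_deg_closed:
  assumes "closed_under M X" "labels_le n M"
  shows "even (\<Sum>l\<in>X \<inter> {..n}. deg l M)"
  using assms
proof (induction M)
  case (add p M)
  have *: "(\<Sum>l\<in>X \<inter> {..n}. of_bool (k = l)) = (of_bool (k \<in> X \<inter> {..n}) :: nat)" for k
    using sum.delta[of "X \<inter> {..n}" k "\<lambda>_. 1 :: nat"] by (simp add: of_bool_def)
  have "(\<Sum>l\<in>X \<inter> {..n}. deg l (add_mset p M)) =
      of_bool (fst p \<in> X \<inter> {..n}) + of_bool (snd (snd p) \<in> X \<inter> {..n}) +
      (\<Sum>l\<in>X \<inter> {..n}. deg l M)"
    by (simp only: deg_simps sum.distrib *)
  then show ?case using add by auto
qed auto

lemma even_sum_subset:
  fixes f :: "'b \<Rightarrow> nat"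
  assumes "finite A" "B \<subseteq> A" "\<And>x. x \<in> A - B \<Longrightarrow> even (f x)"
  shows "even (sum f A) \<longleftrightarrow> even (sum f B)"
proof -
  have "sum f A = sum f (A - B) + sum f B"
    using assms by (metis sum.subset_diff)
  moreover have "even (sum f (A - B))"
    using assms(3) by (intro dvd_sum) auto
  ultimately show ?thesis by simp
qed

text \<open>The complement of a closed set is closed, so only the side containing a fixed root
  \<open>r\<close> has to be examined.\<close>

lemma linkedI:
  assumes "\<And>X p. closed_under M X \<Longrightarrow> r \<in> X \<Longrightarrow> p \<in># M \<Longrightarrow> fst p \<in> X"
  shows "linked M"
  unfolding linked_def
proof (intro allI impI)
  fix X assume X: "closed_under M X"
  show "(\<forall>p\<in>#M. fst p \<in> X) \<or> (\<forall>p\<in>#M. fst p \<notin> X)"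
    using assms[OF X] assms[OF closed_under_Compl[OF X]] by blast
qed

lemma linkedI_bounded:
  assumes "labels_le n M" "\<And>X l. closed_under M X \<Longrightarrow> r \<in> X \<Longrightarrow> l \<le> n \<Longrightarrow> l \<in> X"
  shows "linked M"
  using assms by (intro linkedI[of M r]) (auto simp: labels_le_def)

text \<open>The vertices \<open>q a, \<dots>, q (b - 1)\<close> of a path, each one as a piece of its own whose ends
  carry labels of path vertices at distance at most one.\<close>

inductive spine :: "(nat \<Rightarrow> 'a) \<Rightarrow> nat \<Rightarrow> nat \<Rightarrow> 'a piece multiset \<Rightarrow> bool" for q a where
  spine_Nil: "spine q a a {#}"
| spine_snoc: "spine q a b Q \<Longrightarrow> x \<in> {b - 1, b, b + 1} \<Longrightarrow> y \<in> {b - 1, b, b + 1} \<Longrightarrow>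
    spine q a (Suc b) (add_mset (x, [q b], y) Q)"

lemma spine_le: "spine q a b Q \<Longrightarrow> a \<le> b"
  by (induction rule: spine.induct) auto

lemma spine_append: "spine q b c Q' \<Longrightarrow> spine q a b Q \<Longrightarrow> spine q a c (Q + Q')"
proof (induction rule: spine.induct)
  case (spine_snoc c Q' x y)
  then show ?case using spine.spine_snoc[of q a c "Q + Q'" x y] by simp
qed simp

lemma spine_single:
  "x \<in> {b - 1, b, b + 1} \<Longrightarrow> y \<in> {b - 1, b, b + 1} \<Longrightarrow> spine q b (Suc b) {#(x, [q b], y)#}"
  by (rule spine_snoc[OF spine_Nil])

lemma spine_cont: "spine q a b Q \<Longrightarrow> content Q = mset (map q [a..<b])"
proof (induction rule: spine.induct)
  case (spine_snoc b Q x y)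
  then show ?case using spine_le by fastforce
qed simp

lemma spine_mem:
  "spine q a b Q \<Longrightarrow> p \<in># Q \<Longrightarrow>
    \<exists>k x y. a \<le> k \<and> k < b \<and> p = (x, [q k], y) \<and> x \<in> {k - 1, k, k + 1} \<and> y \<in> {k - 1, k, k + 1}"
proof (induction rule: spine.induct)
  case (spine_snoc b Q x y)
  note le = spine_le[OF spine_snoc.hyps(1)]
  from spine_snoc.prems have "p = (x, [q b], y) \<or> p \<in># Q" by simp
  then show ?case
  proof
    assume "p = (x, [q b], y)"
    then show ?thesis using le spine_snoc.hyps(2,3) by blast
  next
    assume "p \<in># Q"
    from spine_snoc.IH[OF this] show ?thesis using less_Suc_eq by blast
  qed
qed simp

lemma spine_bounded: "spine q a b Q \<Longrightarrow> labels_le b Q"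
  unfolding labels_le_def by (auto dest!: spine_mem)

text \<open>The left label of the piece \<open>q k\<close> decides the parity of the degree of the label \<open>k - 1\<close>.\<close>

lemma chain_up:
  fixes M :: "'a piece multiset"
  assumes "1 \<le> a" "a \<le> b"
  shows "\<exists>Q. spine q a b Q \<and> (\<forall>l. a \<le> l \<longrightarrow> l + 1 < b \<longrightarrow> even (deg l (M + Q))) \<and>
    (\<forall>l. l < a \<longrightarrow> deg l Q = 0) \<and> (\<forall>l. b < l \<longrightarrow> deg l Q = 0) \<and> deg b Q = of_bool (a < b) \<and>
    (\<forall>X l. closed_under Q X \<longrightarrow> a \<le> l \<longrightarrow> l \<le> b \<longrightarrow> (l \<in> X \<longleftrightarrow> a \<in> X))"
  using assms(2)
proof (induction rule: dec_induct)
  case base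
  show ?case by (rule exI[of _ "{#}"]) (simp add: spine_Nil)
next
  case (step b)
  from step.IH obtain Q where Q: "spine q a b Q"
    "\<And>l. a \<le> l \<Longrightarrow> l + 1 < b \<Longrightarrow> even (deg l (M + Q))"
    "\<And>l. l < a \<Longrightarrow> deg l Q = 0" "\<And>l. b < l \<Longrightarrow> deg l Q = 0"
    "\<And>X l. closed_under Q X \<Longrightarrow> a \<le> l \<Longrightarrow> l \<le> b \<Longrightarrow> l \<in> X \<longleftrightarrow> a \<in> X"
    by blast
  \<comment> \<open>All later pieces have labels at least \<open>b\<close>, so the parity of
    \<open>b - 1\<close> becomes final here. The first piece has nothing to correct and takes
    \<open>a\<close>, which leaves the labels below \<open>a\<close> untouched.\<close>
  define x where "x = (if b = a \<or> even (deg (b - 1) (M + Q)) then b else b - 1)"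
  have x: "x = b \<or> x = b - 1" "a \<le> x" "x \<le> b"
    using step.hyps by (auto simp: x_def simp del: deg_simps)
  define Q' where "Q' = add_mset (x, [q b], Suc b) Q"
  have degQ': "deg l Q' = of_bool (x = l) + of_bool (Suc b = l) + deg l Q" for l
    by (simp add: Q'_def)
  have "spine q a (Suc b) Q'"
    unfolding Q'_def using Q(1) x by (intro spine_snoc) auto
  moreover have "even (deg l (M + Q'))" if "a \<le> l" "l + 1 < Suc b" for l
  proof (cases "l + 1 = b")
    case True
    then have l: "l = b - 1" "b \<noteq> a" "b - 1 \<noteq> b" "Suc b \<noteq> b - 1" using that by auto
    show ?thesis
    proof (cases "even (deg (b - 1) (M + Q))")
      case True
      then have "x = b" by (simp add: x_def)
      then show ?thesis using True l by (simp add: degQ')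
    next
      case False
      then have "x = b - 1" using l by (simp add: x_def)
      then show ?thesis using False l by (simp add: degQ')
    qed
  next
    case False
    then have "l + 1 < b" "x \<noteq> l" "Suc b \<noteq> l" using that x by auto
    then show ?thesis using Q(2)[OF that(1)] by (simp add: degQ')
  qed
  moreover have "deg l Q' = 0" if "l < a" for l
    using that Q(3)[of l] x step.hyps by (simp add: degQ')
  moreover have "deg l Q' = 0" if "Suc b < l" for l
    using that Q(4)[of l] x by (simp add: degQ')
  moreover have "deg (Suc b) Q' = of_bool (a < Suc b)"
    using Q(4)[of "Suc b"] x step.hyps by (simp add: degQ')
  moreover have "l \<in> X \<longleftrightarrow> a \<in> X" if "closed_under Q' X" "a \<le> l" "l \<le> Suc b" for X l
  proof -
    have X: "closed_under Q X" "x \<in> X \<longleftrightarrow> Suc b \<in> X"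
      using that(1) by (simp_all add: Q'_def)
    show ?thesis
      using Q(5)[OF X(1) x(2,3)] Q(5)[OF X(1) that(2)] X(2) that(3) le_Suc_eq by blast
  qed
  ultimately show ?case by blast
qed

text \<open>Mirror image of \<open>chain_up\<close>: pieces are chosen from the last one downwards,
  and the right label of the piece \<open>q k\<close> corrects the label \<open>k + 1\<close>. The
  last piece takes \<open>b - 1\<close>, so \<open>b\<close> stays untouched.\<close>

lemma chain_down:
  fixes M :: "'a piece multiset"
  assumes "1 \<le> a" "a \<le> b"
  shows "\<exists>Q. spine q a b Q \<and> (\<forall>l. a < l \<longrightarrow> l < b \<longrightarrow> even (deg l (M + Q))) \<and>
    (\<forall>l. l < a - 1 \<longrightarrow> deg l Q = 0) \<and> (\<forall>l. b \<le> l \<longrightarrow> deg l Q = 0) \<and>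
    (a < b \<longrightarrow> deg (a - 1) Q = 1) \<and>
    (\<forall>X l. closed_under Q X \<longrightarrow> a - 1 \<le> l \<longrightarrow> l \<le> b - 1 \<longrightarrow> (l \<in> X \<longleftrightarrow> b - 1 \<in> X))"
  using assms(2,1)
proof (induction rule: inc_induct)
  case base
  then show ?case by (intro exI[of _ "{#}"]) (auto simp: spine_Nil)
next
  case (step a)
  have "1 \<le> Suc a" by simp
  from step.IH[OF this] obtain Q where Q: "spine q (Suc a) b Q"
    "\<And>l. Suc a < l \<Longrightarrow> l < b \<Longrightarrow> even (deg l (M + Q))"
    "\<And>l. l < a \<Longrightarrow> deg l Q = 0" "\<And>l. b \<le> l \<Longrightarrow> deg l Q = 0"
    "\<And>X l. closed_under Q X \<Longrightarrow> a \<le> l \<Longrightarrow> l \<le> b - 1 \<Longrightarrow> l \<in> X \<longleftrightarrow> b - 1 \<in> X"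
    unfolding diff_Suc_1 by blast
  define y where "y = (if Suc a = b \<or> even (deg (Suc a) (M + Q)) then a else Suc a)"
  have y: "y = a \<or> y = Suc a" "y < b" "a \<le> y" "y \<le> b - 1"
    using step.hyps by (auto simp: y_def simp del: deg_simps)
  define Q' where "Q' = {#(a - 1, [q a], y)#} + Q"
  have degQ': "deg l Q' = of_bool (a - 1 = l) + of_bool (y = l) + deg l Q" for l
    by (simp add: Q'_def)
  have "spine q a b Q'"
    unfolding Q'_def by (rule spine_append[OF Q(1) spine_single]) (use y(1) in auto)
  moreover have "even (deg l (M + Q'))" if "a < l" "l < b" for l
  proof (cases "l = Suc a")
    case True
    show ?thesis
    proof (cases "even (deg (Suc a) (M + Q))")
      case even: True
      then have "y = a" by (simp add: y_def)
      then show ?thesis using even True by (simp add: degQ')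
    next
      case False
      then have "y = Suc a" using True that by (simp add: y_def)
      then show ?thesis using False True by (simp add: degQ')
    qed
  next
    case False
    then have "a - 1 \<noteq> l" "y \<noteq> l" using that y by auto
    then show ?thesis using Q(2)[of l] that False by (simp add: degQ')
  qed
  moreover have "deg l Q' = 0" if "l < a - 1" for l
    using that Q(3)[of l] y by (simp add: degQ')
  moreover have "deg l Q' = 0" if "b \<le> l" for l
    using that Q(4)[of l] y step.hyps by (simp add: degQ')
  moreover have "deg (a - 1) Q' = 1"
    using Q(3)[of "a - 1"] y step.prems by (simp add: degQ')
  moreover have "l \<in> X \<longleftrightarrow> b - 1 \<in> X" if "closed_under Q' X" "a - 1 \<le> l" "l \<le> b - 1" for X l
  proof -
    have X: "closed_under Q X" "a - 1 \<in> X \<longleftrightarrow> y \<in> X"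
      using that(1) by (simp_all add: Q'_def)
    have "l = a - 1 \<or> a \<le> l" using that(2) by auto
    then show ?thesis
      using Q(5)[OF X(1) y(3,4)] Q(5)[OF X(1) _ that(3)] X(2) by blast
  qed
  ultimately show ?case by blast
qed

text \<open>The choice-free walk along \<open>0, ..., b - 1\<close>: it changes parities only at its
  two ends, and nowhere if \<open>b = 1\<close>.\<close>

lemma straight:
  assumes "1 \<le> b"
  shows "\<exists>Q. spine q 1 b Q \<and> (\<forall>l. deg l Q = of_bool (l + 1 < b) + of_bool (1 \<le> l \<and> l < b)) \<and>
    (\<forall>X l. closed_under Q X \<longrightarrow> l < b \<longrightarrow> (l \<in> X \<longleftrightarrow> 0 \<in> X))"
  using assms
proof (induction rule: dec_induct)
  case base
  show ?case by (rule exI[of _ "{#}"]) (simp add: spine_Nil)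
next
  case (step b)
  from step.IH obtain Q where Q: "spine q 1 b Q"
    "\<And>l. deg l Q = of_bool (l + 1 < b) + of_bool (1 \<le> l \<and> l < b)"
    "\<And>X l. closed_under Q X \<Longrightarrow> l < b \<Longrightarrow> l \<in> X \<longleftrightarrow> 0 \<in> X"
    by blast
  define Q' where "Q' = add_mset (b - 1, [q b], b) Q"
  have "spine q 1 (Suc b) Q'"
    unfolding Q'_def using Q(1) by (intro spine_snoc) auto
  moreover have "deg l Q' = of_bool (l + 1 < Suc b) + of_bool (1 \<le> l \<and> l < Suc b)" for l
  proof -
    consider "l = b" | "l + 1 = b" | "l + 1 < b" | "b < l" by linarith
    then show ?thesis using step.hyps by cases (simp_all add: Q'_def Q(2), linarith?)
  qed
  moreover have "l \<in> X \<longleftrightarrow> 0 \<in> X" if "closed_under Q' X" "l < Suc b" for X l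
  proof -
    have X: "closed_under Q X" "b - 1 \<in> X \<longleftrightarrow> b \<in> X"
      using that(1) by (simp_all add: Q'_def)
    have "b - 1 < b" using step.hyps by simp
    from Q(3)[OF X(1) this] show ?thesis using Q(3)[OF X(1)] X(2) that(2) less_Suc_eq by blast
  qed
  ultimately show ?case by blast
qed

text \<open>Handshake lemma over all labels. It spares every construction below the last inner
  label, which the local choices cannot control.\<close>

lemma even_deg_remaining:
  assumes "labels_le (m + 1) M" "k \<in> {1..m}"
    and "\<And>l. l \<in> {1..m} \<Longrightarrow> l \<noteq> k \<Longrightarrow> even (deg l M)" and "even (deg 0 M + deg (m + 1) M)"
  shows "even (deg k M)"
proof -
  have "even (\<Sum>l\<in>UNIV \<inter> {..m + 1}. deg l M)"
    by (rule even_sum_deg_closed) (use assms(1) in \<open>simp_all add: closed_under_def\<close>)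
  moreover have "even (\<Sum>l\<in>UNIV \<inter> {..m + 1}. deg l M) \<longleftrightarrow> even (\<Sum>l\<in>{0, k, m + 1}. deg l M)"
    by (rule even_sum_subset) (use assms(2,3) in auto)
  ultimately show ?thesis using assms(2,4) by auto
qed

text \<open>The labels outside \<open>X\<close> also form a closed set, so a label of odd degree
  cannot be alone there.\<close>

lemma closed_under_end:
  assumes "labels_le n M" "closed_under M X" "l \<notin> X" "l \<le> n" "odd (deg l M)"
  obtains k where "k \<le> n" "k \<noteq> l" "k \<notin> X"
proof (rule ccontr)
  assume "\<not> thesis"
  then have "- X \<inter> {..n} = {l}" using that assms(3,4) by auto
  then show False
    using even_sum_deg_closed[OF closed_under_Compl[OF assms(2)] assms(1)] assms(5) by simp
qed

text \<open>An upward chain touches \<open>m + 1\<close> once and \<open>0\<close> never, so both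
  end labels become odd. The label \<open>0\<close> is joined to the rest by parity alone: it cannot
  be the only odd label of its component. That the spine avoids \<open>0\<close> matters where
  \<open>q 1\<close> need not be a neighbour of \<open>S\<close>.\<close>

lemma spine_odd_even:
  fixes M :: "'a piece multiset"
  assumes "labels_le (m + 1) M" "1 \<le> m" "odd (deg 0 M)" "even (deg (m + 1) M)"
  obtains Q where "spine q 1 (m + 1) Q" "\<And>l. l \<in> {1..m} \<Longrightarrow> even (deg l (M + Q))"
    "linked (M + Q)" "odd (deg 0 (M + Q))" "odd (deg (m + 1) (M + Q))" "deg 0 Q = 0"
proof -
  obtain Q where Q: "spine q 1 (m + 1) Q"
    "\<And>l. 1 \<le> l \<Longrightarrow> l + 1 < m + 1 \<Longrightarrow> even (deg l (M + Q))"
    "\<And>l. l < 1 \<Longrightarrow> deg l Q = 0" "deg (m + 1) Q = of_bool (1 < m + 1)"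
    "\<And>X l. closed_under Q X \<Longrightarrow> 1 \<le> l \<Longrightarrow> l \<le> m + 1 \<Longrightarrow> l \<in> X \<longleftrightarrow> 1 \<in> X"
    using chain_up[OF order.refl, of "m + 1" q M] le_add2 by blast
  have bd: "labels_le (m + 1) (M + Q)"
    using assms(1) spine_bounded[OF Q(1)] by simp
  have ends: "odd (deg 0 (M + Q))" "odd (deg (m + 1) (M + Q))"
    using Q(3)[of 0] Q(4) assms(2-4) by auto
  have low: "even (deg l (M + Q))" if "l \<in> {1..m}" "l \<noteq> m" for l
    using Q(2)[of l] that by simp
  then have "even (deg m (M + Q))"
    using even_deg_remaining[OF bd, of m] ends assms(2) by simp
  then have ev: "even (deg l (M + Q))" if "l \<in> {1..m}" for l
    using low that by blast
  have "linked (M + Q)"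
  proof (rule linkedI_bounded[OF bd, of 1])
    fix X l assume X: "closed_under (M + Q) X" "1 \<in> X" "l \<le> m + 1"
    then have big: "k \<in> X" if "1 \<le> k" "k \<le> m + 1" for k
      using Q(5)[of X k] that by simp
    have "0 \<in> X"
    proof (rule ccontr)
      assume "0 \<notin> X"
      from closed_under_end[OF bd X(1) this _ ends(1)] obtain k where "k \<le> m + 1" "k \<noteq> 0" "k \<notin> X"
        by auto
      then show False using big[of k] by simp
    qed
    then show "l \<in> X" using big[of l] X(3) by (cases "l = 0") auto
  qed
  then show ?thesis using that Q(1) ev ends Q(3)[of 0] by simp
qed

text \<open>The reflected situation: a downward chain touches \<open>0\<close> once and
  \<open>m + 1\<close> never.\<close>

lemma spine_even_odd:
  fixes M :: "'a piece multiset"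
  assumes "labels_le (m + 1) M" "1 \<le> m" "even (deg 0 M)" "odd (deg (m + 1) M)"
  obtains Q where "spine q 1 (m + 1) Q" "\<And>l. l \<in> {1..m} \<Longrightarrow> even (deg l (M + Q))"
    "linked (M + Q)" "odd (deg 0 (M + Q))" "odd (deg (m + 1) (M + Q))"
proof -
  obtain Q where Q: "spine q 1 (m + 1) Q"
    "\<And>l. 1 < l \<Longrightarrow> l < m + 1 \<Longrightarrow> even (deg l (M + Q))"
    "\<And>l. m + 1 \<le> l \<Longrightarrow> deg l Q = 0" "1 < m + 1 \<Longrightarrow> deg (1 - 1) Q = 1"
    "\<And>X l. closed_under Q X \<Longrightarrow> 1 - 1 \<le> l \<Longrightarrow> l \<le> m + 1 - 1 \<Longrightarrow> l \<in> X \<longleftrightarrow> m + 1 - 1 \<in> X"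
    using chain_down[OF order.refl, of "m + 1" q M] le_add2 by blast
  have bd: "labels_le (m + 1) (M + Q)"
    using assms(1) spine_bounded[OF Q(1)] by simp
  have ends: "odd (deg 0 (M + Q))" "odd (deg (m + 1) (M + Q))"
    using Q(3)[of "m + 1"] Q(4) assms(2-4) by auto
  have low: "even (deg l (M + Q))" if "l \<in> {1..m}" "l \<noteq> 1" for l
    using Q(2)[of l] that by simp
  then have "even (deg 1 (M + Q))"
    using even_deg_remaining[OF bd, of 1] ends assms(2) by simp
  then have ev: "even (deg l (M + Q))" if "l \<in> {1..m}" for l
    using low that by blast
  have "linked (M + Q)"
  proof (rule linkedI_bounded[OF bd, of m])
    fix X l assume X: "closed_under (M + Q) X" "m \<in> X" "l \<le> m + 1"
    then have big: "k \<in> X" if "k \<le> m" for k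
      using Q(5)[of X k] that by simp
    have "m + 1 \<in> X"
    proof (rule ccontr)
      assume "m + 1 \<notin> X"
      from closed_under_end[OF bd X(1) this _ ends(2)] obtain k
        where "k \<le> m + 1" "k \<noteq> m + 1" "k \<notin> X" by auto
      then show False using big[of k] by simp
    qed
    then show "l \<in> X" using big[of l] X(3) by (cases "l = m + 1") auto
  qed
  then show ?thesis using that Q(1) ev ends by blast
qed

text \<open>The path is cut after the least label \<open>c\<close> of odd degree; by parity (or by \<open>cross\<close>) the two
  halves are linked by the given pieces.\<close>

lemma spine_cut:
  fixes M :: "'a piece multiset"
  assumes bM: "labels_le (m + 1) M" and par: "even (deg 0 M + deg (m + 1) M)"
    and odd_j: "j \<in> {1..m}" "odd (deg j M)"
    and cross: "odd (deg 0 M) \<Longrightarrow> (\<And>X. closed_under M X \<Longrightarrow> 0 \<in> X \<longleftrightarrow> m + 1 \<in> X)"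
  obtains Q where "spine q 1 (m + 1) Q" "\<And>l. l \<in> {1..m} \<Longrightarrow> even (deg l (M + Q))"
    "linked (M + Q)" "deg 0 (M + Q) \<noteq> 0" "deg (m + 1) (M + Q) \<noteq> 0"
proof -
  define c where "c = (LEAST j. j \<in> {1..m} \<and> odd (deg j M))"
  have c: "c \<in> {1..m}" "odd (deg c M)"
    unfolding c_def using LeastI[of "\<lambda>j. j \<in> {1..m} \<and> odd (deg j M)" j] odd_j by auto
  have below: "even (deg l M)" if "1 \<le> l" "l < c" for l
    using that c(1) not_less_Least[of l "\<lambda>j. j \<in> {1..m} \<and> odd (deg j M)"] by (auto simp: c_def)
  \<comment> \<open>If \<open>m\<close> were the only odd inner label, the handshake lemma would
    fail; hence there is room for a second half above \<open>c\<close>.\<close>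
  have "c < m"
  proof (rule ccontr)
    assume "\<not> c < m"
    then have "c = m" using c(1) by simp
    then show False using even_deg_remaining[OF bM c(1)] below par c(2) by force
  qed
  \<comment> \<open>The straight half ends at \<open>c\<close> and so makes its degree even; the
    labels strictly between \<open>0\<close> and \<open>c\<close> gain 2.\<close>
  obtain Q1 where Q1: "spine q 1 (c + 1) Q1"
    "\<And>l. deg l Q1 = of_bool (l + 1 < c + 1) + of_bool (1 \<le> l \<and> l < c + 1)"
    "\<And>X l. closed_under Q1 X \<Longrightarrow> l < c + 1 \<Longrightarrow> l \<in> X \<longleftrightarrow> 0 \<in> X"
    using straight[of "c + 1" q] le_add2 by blast
  obtain Q2 where Q2: "spine q (c + 1) (m + 1) Q2"
    "\<And>l. c + 1 \<le> l \<Longrightarrow> l + 1 < m + 1 \<Longrightarrow> even (deg l (M + Q1 + Q2))"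
    "\<And>l. l < c + 1 \<Longrightarrow> deg l Q2 = 0" "deg (m + 1) Q2 = of_bool (c + 1 < m + 1)"
    "\<And>X l. closed_under Q2 X \<Longrightarrow> c + 1 \<le> l \<Longrightarrow> l \<le> m + 1 \<Longrightarrow> l \<in> X \<longleftrightarrow> c + 1 \<in> X"
  proof -
    have "1 \<le> c + 1" "c + 1 \<le> m + 1" using \<open>c < m\<close> by auto
    from chain_up[OF this, of q "M + Q1"] show ?thesis using that by blast
  qed
  define Q where "Q = Q1 + Q2"
  have sp: "spine q 1 (m + 1) Q"
    unfolding Q_def by (rule spine_append[OF Q2(1) Q1(1)])
  have bd: "labels_le (m + 1) (M + Q)"
    using bM spine_bounded[OF sp] by simp
  have ends: "deg 0 (M + Q) = deg 0 M + 1" "deg (m + 1) (M + Q) = deg (m + 1) M + 1"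
    using c \<open>c < m\<close> Q2(4) by (simp_all add: Q_def Q1(2) Q2(3))
  have low: "even (deg l (M + Q))" if "l \<in> {1..m}" "l \<noteq> m" for l
  proof -
    consider "l < c" | "l = c" | "c < l" by linarith
    then show ?thesis
    proof cases
      case 1
      then show ?thesis using below[of l] that by (simp add: Q_def Q1(2) Q2(3))
    next
      case 2
      then show ?thesis using c by (simp add: Q_def Q1(2) Q2(3))
    next
      case 3
      then show ?thesis using Q2(2)[of l] that by (simp add: Q_def add.assoc)
    qed
  qed
  have "even (deg m (M + Q))"
    using even_deg_remaining[OF bd, of m] low par ends c by auto
  then have ev: "even (deg l (M + Q))" if "l \<in> {1..m}" for l
    using low that by blast
  have "linked (M + Q)"
  proof (rule linkedI_bounded[OF bd, of 0])
    fix X l assume X: "closed_under (M + Q) X" "0 \<in> X" "l \<le> m + 1"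
    then have lo: "k \<in> X" if "k \<le> c" for k
      using Q1(3)[of X k] that by (simp add: Q_def)
    have hi: "k \<in> X \<longleftrightarrow> m + 1 \<in> X" if "c < k" "k \<le> m + 1" for k
      using Q2(5)[of X k] Q2(5)[of X "m + 1"] that X(1) \<open>c < m\<close> by (simp add: Q_def)
    have "m + 1 \<in> X"
    proof (cases "odd (deg 0 M)")
      case True
      then show ?thesis using cross[of X] X by simp
    next
      case False
      show ?thesis
      proof (rule ccontr)
        assume "m + 1 \<notin> X"
        have "k \<le> c" if "k \<in> X" "k \<le> m + 1" for k
          using hi[of k] that \<open>m + 1 \<notin> X\<close> by force
        \<comment> \<open>The labels up to \<open>c\<close> would form one side of a cut of
          \<open>M\<close>, with \<open>c\<close> as the only odd label there.\<close>
        then have eq: "X \<inter> {..m + 1} = {..c}"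
          using lo \<open>c < m\<close> by auto
        have "even (\<Sum>l\<in>{..c}. deg l M)"
          using even_sum_deg_closed[of M X "m + 1"] X(1) bM eq by simp
        moreover have "even (\<Sum>l\<in>{..c}. deg l M) \<longleftrightarrow> even (\<Sum>l\<in>{0, c}. deg l M)"
          using below by (intro even_sum_subset) auto
        moreover have "c \<noteq> 0" using c by auto
        ultimately show False using False c(2) by simp
      qed
    qed
    then show "l \<in> X" using lo[of l] hi[of l] X(3) by (cases "l \<le> c") auto
  qed
  then show ?thesis using that[OF sp ev] ends by simp
qed

text \<open>The path skips the label \<open>j\<close>, which is reached through the given piece.\<close>

lemma spine_skip:
  fixes M :: "'a piece multiset"
  assumes bM: "labels_le (m + 1) M" and par: "even (deg 0 M + deg (m + 1) M)"
    and even_M: "\<And>l. l \<in> {1..m} \<Longrightarrow> even (deg l M)"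
    and j: "j \<in> {1..m}" "p \<in># M" "fst p = j" "snd (snd p) \<noteq> j"
  obtains Q where "spine q 1 (m + 1) Q" "\<And>l. l \<in> {1..m} \<Longrightarrow> even (deg l (M + Q))"
    "linked (M + Q)" "deg 0 (M + Q) \<noteq> 0" "deg (m + 1) (M + Q) \<noteq> 0"
proof -
  obtain Q1 where Q1: "spine q 1 j Q1"
    "\<And>l. deg l Q1 = of_bool (l + 1 < j) + of_bool (1 \<le> l \<and> l < j)"
    "\<And>X l. closed_under Q1 X \<Longrightarrow> l < j \<Longrightarrow> l \<in> X \<longleftrightarrow> 0 \<in> X"
    using straight[of j q] j(1) atLeastAtMost_iff by blast
  \<comment> \<open>The \<open>m\<close> path pieces laid straight lead only from \<open>0\<close>
    to \<open>m\<close>. Stepping from \<open>j - 1\<close> directly to \<open>j + 1\<close> gains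
    the one label missing for \<open>m + 1\<close>.\<close>
  define P where "P = {#(j - 1, [q j], j + 1)#}"
  have P: "spine q j (j + 1) P" "deg l P = of_bool (j - 1 = l) + of_bool (j + 1 = l)"
    "closed_under P X \<Longrightarrow> j - 1 \<in> X \<longleftrightarrow> j + 1 \<in> X" for l X
    using spine_single[of "j - 1" j "j + 1" q] by (simp_all add: P_def closed_under_def)
  obtain Q2 where Q2: "spine q (j + 1) (m + 1) Q2"
    "\<And>l. j + 1 \<le> l \<Longrightarrow> l + 1 < m + 1 \<Longrightarrow> even (deg l (M + Q1 + P + Q2))"
    "\<And>l. l < j + 1 \<Longrightarrow> deg l Q2 = 0" "deg (m + 1) Q2 = of_bool (j + 1 < m + 1)"
    "\<And>X l. closed_under Q2 X \<Longrightarrow> j + 1 \<le> l \<Longrightarrow> l \<le> m + 1 \<Longrightarrow> l \<in> X \<longleftrightarrow> j + 1 \<in> X"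
  proof -
    have "1 \<le> j + 1" "j + 1 \<le> m + 1" using j(1) by auto
    from chain_up[OF this, of q "M + Q1 + P"] show ?thesis using that by blast
  qed
  define Q where "Q = Q1 + P + Q2"
  have sp: "spine q 1 (m + 1) Q"
    unfolding Q_def by (rule spine_append[OF Q2(1) spine_append[OF P(1) Q1(1)]])
  have bd: "labels_le (m + 1) (M + Q)"
    using bM spine_bounded[OF sp] by simp
  have dQ: "deg l Q = deg l Q1 + deg l P + deg l Q2" for l
    by (simp add: Q_def)
  have ends: "deg 0 (M + Q) = deg 0 M + 1" "deg (m + 1) (M + Q) = deg (m + 1) M + 1"
    using j(1) Q2(4) by (auto simp: dQ Q1(2) P(2) Q2(3))
  have low: "even (deg l (M + Q))" if "l \<in> {1..m}" "l \<noteq> m" for l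
  proof -
    consider "l + 1 < j" | "l + 1 = j" | "l = j" | "j < l" by linarith
    then show ?thesis
    proof cases
      case 4
      then show ?thesis using Q2(2)[of l] that by (simp add: Q_def add.assoc)
    qed (use even_M[of l] that in \<open>auto simp: dQ Q1(2) P(2) Q2(3)\<close>)
  qed
  have "even (deg m (M + Q))"
    using even_deg_remaining[OF bd, of m] low par ends j(1) by auto
  then have ev: "even (deg l (M + Q))" if "l \<in> {1..m}" for l
    using low that by blast
  have "linked (M + Q)"
  proof (rule linkedI_bounded[OF bd, of 0])
    fix X l assume X: "closed_under (M + Q) X" "0 \<in> X" "l \<le> m + 1"
    then have cl: "closed_under Q1 X" "closed_under P X" "closed_under Q2 X" "closed_under M X"
      by (simp_all add: Q_def)
    have lo: "k \<in> X" if "k < j" for k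
      using Q1(3)[OF cl(1) that] X by simp
    then have "j + 1 \<in> X"
      using P(3)[OF cl(2)] j(1) by simp
    then have hi: "k \<in> X" if "j < k" "k \<le> m + 1" for k
      using Q2(5)[OF cl(3), of k] that by simp
    have "snd (snd p) \<in> X"
      using lo hi j bM by (metis labels_le_def nat_neq_iff)
    then have "j \<in> X"
      using closed_underD[OF cl(4) j(2)] j(3) by simp
    then show "l \<in> X" using lo[of l] hi[of l] X(3) by (cases l j rule: linorder_cases) auto
  qed
  then show ?thesis using that[OF sp ev] ends by simp
qed

text \<open>Both ends are odd already, so the spine stays within the labels
  \<open>1, ..., m\<close>. The given piece connects one end label to them, and parity then connects
  the other.\<close>

lemma spine_odd_odd:
  fixes M :: "'a piece multiset"
  assumes bM: "labels_le (m + 1) M" and "1 \<le> m" and odd_M: "odd (deg 0 M)" "odd (deg (m + 1) M)"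
    and p: "p \<in># M" "k \<in> {1..m}"
      "fst p \<in> {0, m + 1} \<and> snd (snd p) = k \<or> snd (snd p) \<in> {0, m + 1} \<and> fst p = k"
  obtains Q where "spine q 1 (m + 1) Q" "\<And>l. l \<in> {1..m} \<Longrightarrow> even (deg l (M + Q))"
    "linked (M + Q)" "odd (deg 0 (M + Q))" "odd (deg (m + 1) (M + Q))"
proof -
  obtain Q1 where Q1: "spine q 1 m Q1"
    "\<And>l. 1 \<le> l \<Longrightarrow> l + 1 < m \<Longrightarrow> even (deg l (M + Q1))"
    "\<And>l. l < 1 \<Longrightarrow> deg l Q1 = 0" "\<And>l. m < l \<Longrightarrow> deg l Q1 = 0"
    "\<And>X l. closed_under Q1 X \<Longrightarrow> 1 \<le> l \<Longrightarrow> l \<le> m \<Longrightarrow> l \<in> X \<longleftrightarrow> 1 \<in> X"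
    using chain_up[OF order.refl \<open>1 \<le> m\<close>, of q M] by blast
  \<comment> \<open>The last piece may not step to \<open>m + 1\<close>: its right end returns to
    \<open>m\<close>, its left end corrects \<open>m - 1\<close>, and for \<open>x = m\<close> it is
    a loop.\<close>
  define x where "x = (if m = 1 \<or> even (deg (m - 1) (M + Q1)) then m else m - 1)"
  define P where "P = {#(x, [q m], m)#}"
  have x: "1 \<le> x" "x \<le> m" "x = m \<or> x = m - 1"
    using \<open>1 \<le> m\<close> by (auto simp: x_def simp del: deg_simps)
  have P: "spine q m (m + 1) P" "deg l P = of_bool (x = l) + of_bool (m = l)" for l
    using spine_single[of x m m q] x by (auto simp: P_def)
  define Q where "Q = Q1 + P"
  have sp: "spine q 1 (m + 1) Q"
    unfolding Q_def by (rule spine_append[OF P(1) Q1(1)])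
  have bd: "labels_le (m + 1) (M + Q)"
    using bM spine_bounded[OF sp] by simp
  have dQ: "deg l Q = deg l Q1 + deg l P" for l
    by (simp add: Q_def)
  have ends: "odd (deg 0 (M + Q))" "odd (deg (m + 1) (M + Q))"
    using x odd_M Q1(3)[of 0] Q1(4)[of "m + 1"] by (auto simp: dQ P(2))
  have low: "even (deg l (M + Q))" if "l \<in> {1..m}" "l \<noteq> m" for l
  proof (cases "l + 1 = m")
    case True
    then have l: "l = m - 1" "m \<noteq> 1" "m \<noteq> m - 1" using that by auto
    show ?thesis
    proof (cases "even (deg (m - 1) (M + Q1))")
      case True
      then have "x = m" by (simp add: x_def)
      then show ?thesis using True l by (simp add: dQ P(2))
    next
      case False
      then have "x = m - 1" using l by (simp add: x_def)
      then show ?thesis using False l by (simp add: dQ P(2))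
    qed
  next
    case False
    then have "l + 1 < m" "x \<noteq> l" "m \<noteq> l" "1 \<le> l" using that x by auto
    then show ?thesis using Q1(2)[of l] by (simp add: dQ P(2))
  qed
  have "even (deg m (M + Q))"
    using even_deg_remaining[OF bd, of m] low ends \<open>1 \<le> m\<close> by simp
  then have ev: "even (deg l (M + Q))" if "l \<in> {1..m}" for l
    using low that by blast
  have "linked (M + Q)"
  proof (rule linkedI_bounded[OF bd, of 1])
    fix X l assume X: "closed_under (M + Q) X" "1 \<in> X" "l \<le> m + 1"
    then have mid: "i \<in> X" if "1 \<le> i" "i \<le> m" for i
      using Q1(5)[of X i] that by (simp add: Q_def)
    have "fst p \<in> X \<longleftrightarrow> snd (snd p) \<in> X"
      using closed_underD[of M X p] X(1) p(1) by simp
    then have "0 \<in> X \<or> m + 1 \<in> X"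
      using p(2,3) mid[of k] by auto
    moreover have "m + 1 \<in> X" if "0 \<in> X"
    proof (rule ccontr)
      assume "m + 1 \<notin> X"
      from closed_under_end[OF bd X(1) this _ ends(2)] obtain i
        where "i \<le> m + 1" "i \<noteq> m + 1" "i \<notin> X" by auto
      then show False using mid[of i] that by (cases "i = 0") auto
    qed
    moreover have "0 \<in> X" if "m + 1 \<in> X"
    proof (rule ccontr)
      assume "0 \<notin> X"
      from closed_under_end[OF bd X(1) this _ ends(1)] obtain i
        where "i \<le> m + 1" "i \<noteq> 0" "i \<notin> X" by auto
      then show False using mid[of i] that by (cases "i = m + 1") auto
    qed
    ultimately show "l \<in> X"
      using mid[of l] X(3) by (cases "l = 0"; cases "l = m + 1") auto
  qed
  then show ?thesis using that[OF sp ev] ends by simp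
qed

text \<open>If the end parities differ, a single chain suffices. If both ends are odd and a piece
  joins an end to an inner label, the spine stays inside. Otherwise the path is cut at an odd inner
  label, or, if there is none, skips \<open>j\<close>, which \<open>p\<close> connects to the
  rest.\<close>

lemma spine_exists:
  fixes M :: "'a piece multiset"
  assumes bM: "labels_le (m + 1) M" and "1 \<le> m"
    and j: "j \<in> {1..m}" "p \<in># M" "fst p = j" "snd (snd p) \<noteq> j"
  obtains Q where "spine q 1 (m + 1) Q" "\<And>l. l \<in> {1..m} \<Longrightarrow> even (deg l (M + Q))"
    "linked (M + Q)" "deg 0 (M + Q) \<noteq> 0" "deg (m + 1) (M + Q) \<noteq> 0"
proof (cases "even (deg 0 M) \<longleftrightarrow> even (deg (m + 1) M)")
  case False
  then consider "odd (deg 0 M)" "even (deg (m + 1) M)" | "even (deg 0 M)" "odd (deg (m + 1) M)"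
    by blast
  then show ?thesis
  proof cases
    case 1
    from spine_odd_even[OF bM \<open>1 \<le> m\<close> this, of q] show ?thesis
      using that by (metis even_zero)
  next
    case 2
    from spine_even_odd[OF bM \<open>1 \<le> m\<close> this, of q] show ?thesis
      using that by (metis even_zero)
  qed
next
  case par: True
  then have par': "even (deg 0 M + deg (m + 1) M)" by simp
  show ?thesis
  proof (cases "odd (deg 0 M) \<and> (\<exists>p'\<in>#M. \<exists>k\<in>{1..m}.
      fst p' \<in> {0, m + 1} \<and> snd (snd p') = k \<or> snd (snd p') \<in> {0, m + 1} \<and> fst p' = k)")
    case True
    then obtain p' k where p': "p' \<in># M" "k \<in> {1..m}"
      "fst p' \<in> {0, m + 1} \<and> snd (snd p') = k \<or> snd (snd p') \<in> {0, m + 1} \<and> fst p' = k"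
      by blast
    from spine_odd_odd[OF bM \<open>1 \<le> m\<close> _ _ p', of q] show ?thesis
      using that True par by (metis even_zero)
  next
    case no_piece: False
    show ?thesis
    proof (cases "\<exists>i\<in>{1..m}. odd (deg i M)")
      case True
      then obtain i where i: "i \<in> {1..m}" "odd (deg i M)" by blast
      have "0 \<in> X \<longleftrightarrow> m + 1 \<in> X" if odd0: "odd (deg 0 M)" and X: "closed_under M X" for X
      proof -
        have split: "fst p' \<in> {0, m + 1} \<longleftrightarrow> snd (snd p') \<in> {0, m + 1}" if "p' \<in># M" for p'
        proof -
          have "fst p' \<in> {0, m + 1} \<union> {1..m}" "snd (snd p') \<in> {0, m + 1} \<union> {1..m}"
            using bM that by (auto simp: labels_le_def)
          then show ?thesis using no_piece odd0 that by blast
        qed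
        \<comment> \<open>No piece joins an end label to an inner one. If moreover \<open>X'\<close>
          separated \<open>0\<close> from \<open>m + 1\<close>, every piece at \<open>0\<close>
          would be a loop and \<open>0\<close> would have even degree.\<close>
        have *: "0 \<notin> X' \<or> m + 1 \<in> X'" if X': "closed_under M X'" for X'
        proof (rule ccontr)
          assume neg: "\<not> ?thesis"
          have "closed_under M {0}"
            unfolding closed_under_def
          proof
            fix p' assume p': "p' \<in># M"
            show "(fst p' \<in> {0}) = (snd (snd p') \<in> {0})"
              using split[OF p'] closed_underD[OF X' p'] neg by auto
          qed
          from even_sum_deg_closed[OF this bM] show False using odd0 by simp
        qed
        from *[OF X] *[OF closed_under_Compl[OF X]] show ?thesis by blast
      qed
      from spine_cut[OF bM par' i this, of q] show ?thesis
        using that by blast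
    next
      case False
      then have "\<And>l. l \<in> {1..m} \<Longrightarrow> even (deg l M)" by blast
      from spine_skip[OF bM par' this j, of q] show ?thesis
        using that by blast
    qed
  qed
qed

section \<open>Breaking lists into pieces and gluing them\<close>

definition piece_ok :: "(nat \<Rightarrow> 'a set) \<Rightarrow> ('a \<Rightarrow> 'a \<Rightarrow> bool) \<Rightarrow> 'a piece \<Rightarrow> bool" where
  "piece_ok N R p \<longleftrightarrow> fst (snd p) \<noteq> [] \<and> hd (fst (snd p)) \<in> N (fst p) \<and>
     last (fst (snd p)) \<in> N (snd (snd p)) \<and> successively R (fst (snd p))"

fun glue :: "'a piece list \<Rightarrow> 'a list" where
  "glue [] = []"
| "glue (p # ps) = fst (snd p) @ glue ps"

lemma glue_append [simp]: "glue (ps @ qs) = glue ps @ glue qs"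
  by (induction ps) auto

lemma content_mset: "content (mset qs) = mset (glue qs)"
  by (induction qs) auto

definition cliques :: "(nat \<Rightarrow> 'a set) \<Rightarrow> ('a \<Rightarrow> 'a \<Rightarrow> bool) \<Rightarrow> bool" where
  "cliques N R \<longleftrightarrow> (\<forall>l. \<forall>x\<in>N l. \<forall>y\<in>N l. x \<noteq> y \<longrightarrow> R x y)"

lemma piece_ok_flip:
  assumes "symp R" "piece_ok N R p"
  shows "piece_ok N R (flip p)"
proof -
  have "(\<lambda>x y. R y x) = R" using assms(1) by (auto simp: symp_def)
  then have "successively R (rev xs) \<longleftrightarrow> successively R xs" for xs
    by (simp only: successively_rev)
  then show ?thesis
    using assms(2) by (simp add: piece_ok_def hd_rev last_rev del: successively_rev)
qed

text \<open>Where two pieces meet, the adjoining vertices share a label and thus lie in one clique;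
  distinctness of the whole list makes them different, as \<open>cliques\<close> demands.\<close>

lemma glue_trail:
  assumes "trail a qs b" "qs \<noteq> []" "\<And>p. p \<in> set qs \<Longrightarrow> piece_ok N R p" "distinct (glue qs)"
    and clique: "cliques N R"
  shows "glue qs \<noteq> [] \<and> hd (glue qs) \<in> N a \<and> last (glue qs) \<in> N b \<and> successively R (glue qs)"
  using assms(1-4)
proof (induction qs arbitrary: a)
  case (Cons p qs)
  have p: "piece_ok N R p" "fst p = a" using Cons.prems by auto
  show ?case
  proof (cases "qs = []")
    case True
    then show ?thesis using p Cons.prems(1) by (auto simp: piece_ok_def)
  next
    case False
    have IH: "glue qs \<noteq> []" "hd (glue qs) \<in> N (snd (snd p))" "last (glue qs) \<in> N b"
      "successively R (glue qs)"
      using Cons.IH[of "snd (snd p)"] Cons.prems False by auto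
    have "last (fst (snd p)) \<in> set (fst (snd p))" "hd (glue qs) \<in> set (glue qs)"
      using p(1) hd_in_set[OF IH(1)] by (auto simp: piece_ok_def)
    then have "last (fst (snd p)) \<noteq> hd (glue qs)"
      using Cons.prems(4) by auto
    then have "R (last (fst (snd p))) (hd (glue qs))"
      using clique p(1) IH(2) by (auto simp: piece_ok_def cliques_def)
    then show ?thesis
      using p IH by (auto simp: piece_ok_def successively_append_iff hd_append)
  qed
qed simp

text \<open>Gluing reverses pieces at most and never tears them apart. This carries the prescribed
  edge into the final list.\<close>

lemma content_sublist:
  assumes "reoriented M (mset qs)" "p \<in># M"
  shows "sublist (fst (snd p)) (glue qs) \<or> sublist (rev (fst (snd p))) (glue qs)"
proof -
  have *: "sublist (fst (snd q)) (glue qs)" if q: "q \<in> set qs" for q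
  proof -
    obtain us vs where "qs = us @ q # vs" using split_list[OF q] by blast
    then show ?thesis by (simp add: sublist_appendI)
  qed
  from reoriented_set[OF assms] have "p \<in> set qs \<or> flip p \<in> set qs" by simp
  then show ?thesis using *[of p] *[of "flip p"] by auto
qed

lemma distinct_of_mset_set: "mset xs = mset_set A \<Longrightarrow> finite A \<Longrightarrow> distinct xs \<and> set xs = A"
  by (metis finite_distinct_list finite_set_mset_mset_set mset_eq_imp_distinct_iff mset_set_set
      set_mset_mset)

lemma assemble_open:
  assumes ok: "\<And>p. p \<in># M \<Longrightarrow> piece_ok N R p" and "symp R"
    and clique: "cliques N R"
    and W: "content M = mset_set W" "finite W"
    and "\<And>l. l \<noteq> a \<Longrightarrow> l \<noteq> b \<Longrightarrow> even (deg l M)" "odd (deg a M)" "odd (deg b M)" "linked M" "a \<noteq> b"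
  obtains L where "L \<noteq> []" "distinct L" "set L = W" "hd L \<in> N a" "last L \<in> N b" "successively R L"
    "\<And>p. p \<in># M \<Longrightarrow> sublist (fst (snd p)) L \<or> sublist (rev (fst (snd p))) L"
proof -
  obtain qs where qs: "trail a qs b" "reoriented M (mset qs)"
    using Euler_open assms(6-10) by metis
  have "piece_ok N R p" if "p \<in> set qs" for p
    using reoriented_set[OF reoriented_sym[OF qs(2)], of p] ok[of p] ok[of "flip p"]
      piece_ok_flip[OF \<open>symp R\<close>, of N "flip p"] that by auto
  moreover have "mset (glue qs) = mset_set W"
    using reoriented_cont[OF qs(2)] W(1) by (simp only: content_mset)
  then have "distinct (glue qs)" "set (glue qs) = W"
    using distinct_of_mset_set W(2) by blast+
  moreover have "qs \<noteq> []" using qs(1) \<open>a \<noteq> b\<close> by auto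
  ultimately show ?thesis
    using glue_trail[OF qs(1) _ _ _ clique] content_sublist[OF qs(2)]
    by (intro that[of "glue qs"]) auto
qed

lemma assemble_closed:
  assumes ok: "\<And>p. p \<in># M \<Longrightarrow> piece_ok N R p" and "symp R"
    and clique: "cliques N R"
    and W: "content M = mset_set W" "finite W"
    and "\<And>l. even (deg l M)" "linked M" "deg a M \<noteq> 0" "deg b M \<noteq> 0" "a \<noteq> b"
  obtains L1 L2 where "L1 \<noteq> []" "L2 \<noteq> []" "distinct (L1 @ L2)" "set (L1 @ L2) = W"
    "hd L1 \<in> N a" "last L1 \<in> N b" "successively R L1"
    "hd L2 \<in> N b" "last L2 \<in> N a" "successively R L2"
proof -
  obtain us vs where uv: "trail a us b" "trail b vs a" "reoriented M (mset us + mset vs)"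
    using Euler_closed_through assms(6-10) by metis
  have ok': "piece_ok N R p" if "p \<in> set us \<union> set vs" for p
    using reoriented_set[OF reoriented_sym[OF uv(3)], of p] ok[of p] ok[of "flip p"]
      piece_ok_flip[OF \<open>symp R\<close>, of N "flip p"] that by auto
  have "mset (glue us @ glue vs) = mset_set W"
    using reoriented_cont[OF uv(3)] W(1) content_mset[of "us @ vs"] by simp
  then have d: "distinct (glue us @ glue vs)" "set (glue us @ glue vs) = W"
    using distinct_of_mset_set W(2) by blast+
  have ne: "us \<noteq> []" "vs \<noteq> []" using uv(1,2) \<open>a \<noteq> b\<close> by auto
  have "distinct (glue us)" "distinct (glue vs)"
    using d(1) distinct_append by blast+
  then have "glue us \<noteq> [] \<and> hd (glue us) \<in> N a \<and> last (glue us) \<in> N b \<and> successively R (glue us)"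
    "glue vs \<noteq> [] \<and> hd (glue vs) \<in> N b \<and> last (glue vs) \<in> N a \<and> successively R (glue vs)"
    using glue_trail[OF uv(1) ne(1) _ _ clique]
      glue_trail[OF uv(2) ne(2) _ _ clique] ok' by blast+
  then show ?thesis using that d by blast
qed

section \<open>Cutting a list at its steps outside \<open>R\<close>\<close>

lemma sublist_pair_snoc:
  assumes "sublist [u, v] (L @ [y])"
  shows "sublist [u, v] L \<or> (L \<noteq> [] \<and> u = last L \<and> v = y)"
proof -
  obtain us vs where *: "L @ [y] = us @ [u, v] @ vs"
    using assms by (auto simp: sublist_def)
  show ?thesis
  proof (cases vs rule: rev_cases)
    case Nil
    then have "L @ [y] = (us @ [u]) @ [v]" using * by simp
    then have "L = us @ [u]" "v = y" by (simp_all only: append1_eq_conv)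
    then show ?thesis by simp
  next
    case (snoc ws w)
    then have "L = us @ [u, v] @ ws" using * by (metis append_assoc append1_eq_conv)
    then show ?thesis by (auto simp: sublist_def)
  qed
qed

text \<open>A step outside \<open>R\<close> has both vertices in \<open>C\<close>; these supply the
  right label of the piece ending there and the left label of the next one. Steps in
  \<open>R\<close> stay inside a piece. The last fragment \<open>xs\<close> is returned without a
  right label, which the caller is free to choose.\<close>

lemma break_list:
  assumes "L \<noteq> []" "successively (\<lambda>x y. R x y \<or> x \<in> C \<and> y \<in> C) L" "hd L \<in> N a"
    and C: "\<And>x. x \<in> C \<Longrightarrow> \<exists>l\<in>J. x \<in> N l"
  shows "\<exists>ps i xs. L = glue ps @ xs \<and> xs \<noteq> [] \<and> hd xs \<in> N i \<and> successively R xs \<and>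
    (\<forall>p\<in>set ps. piece_ok N R p \<and> fst p \<in> insert a J \<and> snd (snd p) \<in> J) \<and> i \<in> insert a J \<and>
    (if ps = [] then i = a else fst (hd ps) = a) \<and>
    (\<forall>u v. sublist [u, v] L \<longrightarrow> R u v \<longrightarrow> sublist [u, v] xs \<or> (\<exists>p\<in>set ps. sublist [u, v] (fst (snd p))))"
  using assms(1-3)
proof (induction L rule: rev_nonempty_induct)
  case (single x)
  then show ?case
    by (intro exI[of _ "[]"] exI[of _ a] exI[of _ "[x]"]) (auto simp: sublist_Cons_right)
next
  case (snoc y L)
  have L: "successively (\<lambda>x y. R x y \<or> x \<in> C \<and> y \<in> C) L" "hd L \<in> N a"
    "R (last L) y \<or> last L \<in> C \<and> y \<in> C"
    using snoc.prems snoc.hyps by (auto simp: successively_append_iff)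
  from snoc.IH[OF L(1,2)] obtain ps i xs where IH: "L = glue ps @ xs" "xs \<noteq> []" "hd xs \<in> N i"
    "successively R xs"
    "\<forall>p\<in>set ps. piece_ok N R p \<and> fst p \<in> insert a J \<and> snd (snd p) \<in> J" "i \<in> insert a J"
    "if ps = [] then i = a else fst (hd ps) = a"
    "\<And>u v. sublist [u, v] L \<Longrightarrow> R u v \<Longrightarrow> sublist [u, v] xs \<or> (\<exists>p\<in>set ps. sublist [u, v] (fst (snd p)))"
    by blast
  have last: "last L = last xs" using IH(1,2) by simp
  show ?case
  proof (cases "R (last L) y")
    case True
    have "sublist [u, v] (xs @ [y]) \<or> (\<exists>p\<in>set ps. sublist [u, v] (fst (snd p)))"
      if "sublist [u, v] (L @ [y])" "R u v" for u v
    proof -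
      have new: "sublist [last xs, y] (xs @ [y])"
        using IH(2) by (cases xs rule: rev_cases) (simp_all add: sublist_append_leftI)
      have old: "sublist [u, v] xs \<Longrightarrow> sublist [u, v] (xs @ [y])"
        by (rule sublist_order.order_trans[OF _ sublist_append_rightI])
      from sublist_pair_snoc[OF that(1)] show ?thesis
      proof
        assume "sublist [u, v] L"
        from IH(8)[OF this that(2)] show ?thesis using old by blast
      next
        assume "L \<noteq> [] \<and> u = last L \<and> v = y"
        then show ?thesis using new last by simp
      qed
    qed
    moreover have "successively R (xs @ [y])"
      using IH(2,4) True last by (simp add: successively_append_iff)
    ultimately show ?thesis
      using IH(1-3,5-7) by (intro exI[of _ ps] exI[of _ i] exI[of _ "xs @ [y]"]) auto
  next
    case False
    then have "last L \<in> C" "y \<in> C" using L(3) by auto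
    then obtain l l' where l: "l \<in> J" "last L \<in> N l" "l' \<in> J" "y \<in> N l'"
      using C by meson
    define ps' where "ps' = ps @ [(i, xs, l)]"
    have "sublist [u, v] [y] \<or> (\<exists>p\<in>set ps'. sublist [u, v] (fst (snd p)))"
      if "sublist [u, v] (L @ [y])" "R u v" for u v
      using sublist_pair_snoc[OF that(1)] IH(8)[OF _ that(2)] False that(2)
      by (auto simp: ps'_def)
    moreover have "\<forall>p\<in>set ps'. piece_ok N R p \<and> fst p \<in> insert a J \<and> snd (snd p) \<in> J"
      using IH(2-6) l last by (auto simp: ps'_def piece_ok_def)
    moreover have "ps' \<noteq> []" "fst (hd ps') = a"
      using IH(7) by (auto simp: ps'_def hd_append)
    moreover have "L @ [y] = glue ps' @ [y]"
      using IH(1) by (simp add: ps'_def)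
    ultimately show ?thesis
      using l(3,4) by (intro exI[of _ ps'] exI[of _ l'] exI[of _ "[y]"]) auto
  qed
qed

section \<open>Connectivity\<close>

locale sgraph =
  fixes E :: "'a \<Rightarrow> 'a \<Rightarrow> bool"
  assumes E_sym: "E x y \<Longrightarrow> E y x" and E_irrefl: "\<not> E x x"
begin

definition nb :: "'a set \<Rightarrow> 'a set" where
  "nb S = {v. \<exists>s\<in>S. E s v}"

definition adj2 :: "'a \<Rightarrow> 'a \<Rightarrow> bool" where
  "adj2 x y \<longleftrightarrow> E x y \<or> (\<exists>c. E x c \<and> E c y)"

inductive con :: "'a set \<Rightarrow> 'a \<Rightarrow> 'a \<Rightarrow> bool" for U where
  con_refl: "a \<in> U \<Longrightarrow> con U a a"
| con_step: "con U a b \<Longrightarrow> E b c \<Longrightarrow> c \<in> U \<Longrightarrow> con U a c"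

definition connected :: "'a set \<Rightarrow> bool" where
  "connected U \<longleftrightarrow> (\<forall>x\<in>U. \<forall>y\<in>U. con U x y)"

definition component :: "'a set \<Rightarrow> 'a \<Rightarrow> 'a set" where
  "component U a = {b. con U a b}"

section \<open>Walks, components and paths inside a vertex set\<close>

lemma nb_iff: "v \<in> nb S \<longleftrightarrow> (\<exists>s\<in>S. E s v)"
  by (simp add: nb_def)

lemma nb_Un [simp]: "nb (S \<union> T) = nb S \<union> nb T"
  by (auto simp: nb_def)

lemma nb_single [simp]: "v \<in> nb {s} \<longleftrightarrow> E s v"
  by (simp add: nb_def)

lemma adj2_sym: "adj2 x y \<Longrightarrow> adj2 y x"
  using E_sym unfolding adj2_def by blast

lemma adj2_common: "x \<in> nb {c} \<Longrightarrow> y \<in> nb {c} \<Longrightarrow> adj2 x y"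
  using E_sym unfolding adj2_def by auto

lemma con_in: "con U a b \<Longrightarrow> a \<in> U \<and> b \<in> U"
  by (induction rule: con.induct) auto

lemma con_trans: "con U b c \<Longrightarrow> con U a b \<Longrightarrow> con U a c"
  by (induction rule: con.induct) (auto intro: con_step)

lemma con_edge: "a \<in> U \<Longrightarrow> b \<in> U \<Longrightarrow> E a b \<Longrightarrow> con U a b"
  by (meson con_refl con_step)

lemma con_sym: "con U a b \<Longrightarrow> con U b a"
proof (induction rule: con.induct)
  case (con_step a b c)
  then have "con U c b" using con_edge[of c U b] con_in[of U a b] E_sym[of b c] by simp
  from con_trans[OF con_step.IH this] show ?case .
qed (rule con_refl)

lemma con_mono: "con U a b \<Longrightarrow> U \<subseteq> U' \<Longrightarrow> con U' a b"
  by (induction rule: con.induct) (auto intro: con_refl con_step)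

text \<open>The tool behind all proofs that anchoring is inherited: a walk that leaves
  \<open>Y\<close> has a last vertex before its first exit, still reachable within
  \<open>Y\<close>.\<close>

lemma first_exit:
  assumes "con U x v" "x \<in> Y"
  shows "con Y x v \<or> (\<exists>u u'. con Y x u \<and> E u u' \<and> u' \<in> U - Y)"
  using assms
  by (induction rule: con.induct) (blast intro: con_refl con_step)+

lemma con_component: "con U a b \<Longrightarrow> con (component U a) a b"
proof (induction rule: con.induct)
  case (con_refl a)
  then show ?case using con.con_refl by (simp add: component_def con.con_refl)
next
  case (con_step a b c)
  then have "con U a c" by (meson con.con_step)
  then show ?case using con_step.IH con_step.hyps(2) con.con_step component_def by blast
qed

lemma component_subset: "component U a \<subseteq> U"
  using con_in by (auto simp: component_def)

lemma component_self: "a \<in> U \<Longrightarrow> a \<in> component U a"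
  by (simp add: component_def con_refl)

lemma connected_component: "connected (component U a)"
  unfolding connected_def
proof (intro ballI)
  fix x y assume "x \<in> component U a" "y \<in> component U a"
  then have "con (component U a) a x" "con (component U a) a y"
    using con_component by (auto simp: component_def)
  then show "con (component U a) x y" using con_sym con_trans[of "component U a" a y x] by blast
qed

lemma component_exit: "x \<in> component U a \<Longrightarrow> E x y \<Longrightarrow> y \<in> U \<Longrightarrow> y \<in> component U a"
  unfolding component_def using con_step by blast

lemma component_eq: "b \<in> component U a \<Longrightarrow> component U b = component U a"
  unfolding component_def using con_sym con_trans by blast

lemma components_disjoint: "pairwise disjnt (component U ` U)"
  unfolding pairwise_def disjnt_def using component_eq by blast

lemma Union_components: "\<Union> (component U ` U) = U"
  using component_subset component_self by fastforce

lemma con_path: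
  "con U a b \<Longrightarrow> \<exists>ps. ps \<noteq> [] \<and> hd ps = a \<and> last ps = b \<and> distinct ps \<and> set ps \<subseteq> U \<and> successively E ps"
proof (induction rule: con.induct)
  case (con_refl a)
  then show ?case by (intro exI[of _ "[a]"]) auto
next
  case (con_step a b c)
  then obtain ps where ps: "ps \<noteq> []" "hd ps = a" "last ps = b" "distinct ps" "set ps \<subseteq> U"
    "successively E ps" by blast
  show ?case
  proof (cases "c \<in> set ps")
    case True
    then obtain us vs where uv: "ps = us @ c # vs" by (meson split_list)
    then have "hd (us @ [c]) = a" "set (us @ [c]) \<subseteq> U" "distinct (us @ [c])"
      using ps by (auto simp: hd_append)
    moreover have "successively E (us @ [c])"
      using ps(6) uv by (auto simp: successively_append_iff)
    ultimately show ?thesis by (intro exI[of _ "us @ [c]"]) auto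
  next
    case False
    then show ?thesis
      using ps con_step.hyps by (intro exI[of _ "ps @ [c]"]) (auto simp: successively_append_iff)
  qed
qed

lemma path_con:
  assumes "successively E ps" "u \<in> set ps" "v \<in> set ps"
  shows "con (set ps) u v"
proof -
  have "con (set ps) (hd ps) u" if "successively E ps" "u \<in> set ps" for ps u
    using that
  proof (induction ps arbitrary: u rule: rev_induct)
    case (snoc x ps)
    show ?case
    proof (cases "ps = []")
      case True
      then show ?thesis using snoc.prems by (simp add: con_refl)
    next
      case False
      have s: "successively E ps" "E (last ps) x"
        using snoc.prems(1) False by (auto simp: successively_append_iff)
      have old: "con (set (ps @ [x])) (hd (ps @ [x])) w" if "w \<in> set ps" for w
        using con_mono[OF snoc.IH[OF s(1) that], of "set (ps @ [x])"] False by (auto simp: hd_append)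
      have "con (set (ps @ [x])) (hd (ps @ [x])) x"
        using con_step[OF old[OF last_in_set[OF False]] s(2)] by simp
      then show ?thesis using old snoc.prems(2) by auto
    qed
  qed simp
  from con_trans[OF this[OF assms(1,3)] con_sym[OF this[OF assms(1,2)]]] show ?thesis .
qed

text \<open>The deleted vertex lies on at most one side of \<open>u\<close>, so the other side of
  the path still leads to its end.\<close>

lemma path_avoid:
  assumes "successively E ps" "distinct ps" "u \<in> set ps" "u \<noteq> c"
  shows "con (set ps - {c}) u (hd ps) \<or> con (set ps - {c}) u (last ps)"
proof -
  obtain us vs where uv: "ps = us @ u # vs" using assms(3) by (meson split_list)
  have s: "successively E (us @ [u])" "successively E (u # vs)"
    using assms(1) uv by (auto simp: successively_append_iff)
  have "c \<notin> set (us @ [u]) \<or> c \<notin> set (u # vs)"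
    using assms(2,4) uv by auto
  then show ?thesis
  proof
    assume c: "c \<notin> set (us @ [u])"
    have "con (set (us @ [u])) u (hd ps)"
      by (rule path_con[OF s(1)]) (auto simp: uv hd_append)
    then have "con (set ps - {c}) u (hd ps)"
      by (rule con_mono) (use c in \<open>auto simp: uv\<close>)
    then show ?thesis ..
  next
    assume c: "c \<notin> set (u # vs)"
    have "con (set (u # vs)) u (last ps)"
      by (rule path_con[OF s(2)]) (auto simp: uv)
    then have "con (set ps - {c}) u (last ps)"
      by (rule con_mono) (use c in \<open>auto simp: uv\<close>)
    then show ?thesis ..
  qed
qed

text \<open>If \<open>W\<close> is connected, \<open>anchored W S\<close> says that contracting \<open>S\<close> to a vertex attached to \<open>W\<close> leaves
  no cut vertex in \<open>W\<close>; in \<open>anchored_to\<close> the new vertex is also joined to \<open>z\<close>.\<close>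

definition anchored :: "'a set \<Rightarrow> 'a set \<Rightarrow> bool" where
  "anchored W S \<longleftrightarrow> (\<forall>c. \<forall>w\<in>W - {c}. \<exists>v\<in>nb S. con (W - {c}) w v)"

definition anchored_to :: "'a set \<Rightarrow> 'a set \<Rightarrow> 'a \<Rightarrow> bool" where
  "anchored_to W S z \<longleftrightarrow> connected W \<and> z \<in> W \<and>
     (\<forall>c. \<forall>w\<in>W - {c}. \<exists>v. con (W - {c}) w v \<and> (v \<in> nb S \<or> v = z))"

text \<open>Two neighbours of \<open>S\<close> come within distance 2 once \<open>S\<close> is
  contracted. For a singleton this adds nothing, so the final list is a path in the square.\<close>

definition link :: "'a set \<Rightarrow> 'a \<Rightarrow> 'a \<Rightarrow> bool" where
  "link S x y \<longleftrightarrow> adj2 x y \<or> x \<in> nb S \<and> y \<in> nb S"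

definition edge_at :: "'a \<Rightarrow> 'a list \<Rightarrow> bool" where
  "edge_at t L \<longleftrightarrow> (\<exists>b. E t b \<and> (sublist [t, b] L \<or> sublist [b, t] L))"

lemma link_single [simp]: "link {c} x y \<longleftrightarrow> adj2 x y"
  using adj2_common unfolding link_def by blast

lemma edge_at_mono: "edge_at t L \<Longrightarrow> sublist L L' \<or> sublist (rev L) L' \<Longrightarrow> edge_at t L'"
proof -
  assume t: "edge_at t L" and L: "sublist L L' \<or> sublist (rev L) L'"
  obtain b where b: "E t b" "sublist [t, b] L \<or> sublist [b, t] L"
    using t by (auto simp: edge_at_def)
  then have "sublist [b, t] (rev L) \<or> sublist [t, b] (rev L)"
    using sublist_rev[of "[t, b]" L] sublist_rev[of "[b, t]" L] by auto
  then show ?thesis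
    using b L sublist_order.order_trans unfolding edge_at_def by blast
qed

end

text \<open>\<open>Q\<close> and \<open>F\<close> carry one distinguished piece through the union: a
  piece with two different labels in one application, a piece containing the edge at
  \<open>t\<close> in the other.\<close>

lemma collect_pieces:
  fixes \<K> :: "'a set set"
  assumes "finite \<K>" "pairwise disjnt \<K>" "\<And>K. K \<in> \<K> \<Longrightarrow> finite K"
    and "\<And>K. K \<in> \<K> \<Longrightarrow> \<exists>M. content M = mset_set K \<and> (\<forall>p\<in>#M. P p) \<and> (Q K \<longrightarrow> (\<exists>p\<in>#M. F p))"
  shows "\<exists>M. content M = mset_set (\<Union>\<K>) \<and> (\<forall>p\<in>#M. P p) \<and> ((\<exists>K\<in>\<K>. Q K) \<longrightarrow> (\<exists>p\<in>#M. F p))"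
  using assms
proof (induction \<K> rule: finite_induct)
  case empty
  show ?case by (intro exI[of _ "{#}"]) auto
next
  case (insert K \<K>)
  obtain M where M: "content M = mset_set (\<Union>\<K>)" "\<forall>p\<in>#M. P p" "(\<exists>K\<in>\<K>. Q K) \<longrightarrow> (\<exists>p\<in>#M. F p)"
    using insert.IH insert.prems by (auto simp: pairwise_insert)
  obtain M' where M': "content M' = mset_set K" "\<forall>p\<in>#M'. P p" "Q K \<longrightarrow> (\<exists>p\<in>#M'. F p)"
    using insert.prems(3)[of K] by auto
  have "K \<inter> \<Union>\<K> = {}"
    using insert.prems(1) insert.hyps(2) by (auto simp: pairwise_insert disjnt_def)
  then have "content (M' + M) = mset_set (\<Union>(insert K \<K>))"
    using M(1) M'(1) insert by (simp add: mset_set_Union)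
  then show ?case
    using M M' by (intro exI[of _ "M' + M"]) auto
qed

section \<open>Covering a set by lists between two sides\<close>

lemma break_list_closed:
  assumes "L \<noteq> []" "successively (\<lambda>x y. R x y \<or> x \<in> C \<and> y \<in> C) L" "hd L \<in> N a"
    and "\<And>x. x \<in> C \<Longrightarrow> \<exists>l\<in>J. x \<in> N l" and "b \<in> J" "last L \<in> N b"
  obtains ps where "ps \<noteq> []" "glue ps = L" "fst (hd ps) = a"
    "\<And>p. p \<in> set ps \<Longrightarrow> piece_ok N R p \<and> fst p \<in> insert a J \<and> snd (snd p) \<in> J"
    "\<And>u v. sublist [u, v] L \<Longrightarrow> R u v \<Longrightarrow> \<exists>p\<in>set ps. sublist [u, v] (fst (snd p))"
proof -
  obtain ps i xs where ps: "L = glue ps @ xs" "xs \<noteq> []" "hd xs \<in> N i" "successively R xs"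
    "\<forall>p\<in>set ps. piece_ok N R p \<and> fst p \<in> insert a J \<and> snd (snd p) \<in> J" "i \<in> insert a J"
    "if ps = [] then i = a else fst (hd ps) = a"
    "\<And>u v. sublist [u, v] L \<Longrightarrow> R u v \<Longrightarrow> sublist [u, v] xs \<or> (\<exists>p\<in>set ps. sublist [u, v] (fst (snd p)))"
    using break_list[OF assms(1-4)] by blast
  define qs where "qs = ps @ [(i, xs, b)]"
  have "piece_ok N R (i, xs, b)"
    using ps(1-4) assms(6) by (simp add: piece_ok_def)
  then have "piece_ok N R p \<and> fst p \<in> insert a J \<and> snd (snd p) \<in> J" if "p \<in> set qs" for p
    using ps(5,6) assms(5) that by (auto simp: qs_def)
  moreover have "qs \<noteq> []" "glue qs = L" "fst (hd qs) = a"
    using ps(1,7) by (auto simp: qs_def hd_append)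
  moreover have "\<exists>p\<in>set qs. sublist [u, v] (fst (snd p))" if "sublist [u, v] L" "R u v" for u v
    using ps(8)[OF that] by (auto simp: qs_def)
  ultimately show ?thesis using that by blast
qed

lemma map_nth_shift: "map (\<lambda>k. xs ! (k - 1)) [1..<length xs + 1] = xs"
  by (rule nth_equalityI) (simp_all del: upt_Suc)

text \<open>Since \<open>a\<close> is not in \<open>J\<close>, the first piece of a list joins two
  different labels; this supplies the piece that \<open>spine_exists\<close> asks for.\<close>

lemma break_lists:
  assumes "\<And>L. L \<in> set ts \<Longrightarrow> L \<noteq> [] \<and> successively (\<lambda>x y. R x y \<or> x \<in> C \<and> y \<in> C) L \<and> hd L \<in> N a \<and> (\<exists>b\<in>J. last L \<in> N b)"
    and C: "\<And>x. x \<in> C \<Longrightarrow> \<exists>l\<in>J. x \<in> N l" and "a \<notin> J"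
  shows "\<exists>M. content M = mset (concat ts) \<and>
    (\<forall>p\<in>#M. piece_ok N R p \<and> fst p \<in> insert a J \<and> snd (snd p) \<in> J) \<and>
    (ts \<noteq> [] \<longrightarrow> (\<exists>p\<in>#M. fst p = a \<and> snd (snd p) \<noteq> a))"
  using assms(1)
proof (induction ts)
  case Nil
  show ?case by (intro exI[of _ "{#}"]) simp
next
  case (Cons L ts)
  obtain M where M: "content M = mset (concat ts)"
    "\<forall>p\<in>#M. piece_ok N R p \<and> fst p \<in> insert a J \<and> snd (snd p) \<in> J"
    using Cons.IH Cons.prems by (meson list.set_intros(2))
  have "L \<noteq> []" "successively (\<lambda>x y. R x y \<or> x \<in> C \<and> y \<in> C) L" "hd L \<in> N a" "\<exists>b\<in>J. last L \<in> N b"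
    using Cons.prems[of L] by simp_all
  then obtain ps where ps: "ps \<noteq> []" "glue ps = L" "fst (hd ps) = a"
    "\<And>p. p \<in> set ps \<Longrightarrow> piece_ok N R p \<and> fst p \<in> insert a J \<and> snd (snd p) \<in> J"
    using break_list_closed[of L R C N a J] C by blast
  have "snd (snd (hd ps)) \<noteq> a"
    using ps(4)[OF hd_in_set[OF ps(1)]] \<open>a \<notin> J\<close> by auto
  then have "\<exists>p\<in>#mset ps + M. fst p = a \<and> snd (snd p) \<noteq> a"
    using ps(1,3) by (intro bexI[of _ "hd ps"]) auto
  moreover have "content (mset ps + M) = mset (concat (L # ts))"
    using M(1) ps(2) by (simp add: content_mset)
  moreover have "\<forall>p\<in>#mset ps + M. piece_ok N R p \<and> fst p \<in> insert a J \<and> snd (snd p) \<in> J"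
    using M(2) ps(4) by auto
  ultimately show ?case by blast
qed

context sgraph
begin

text \<open>A walk towards \<open>S\<close> or \<open>Q\<close> that leaves the component must enter
  \<open>Q\<close>, so the vertex before the exit is a neighbour of \<open>Q\<close>. The hypothesis
  is common to both forms of anchoring, with \<open>z\<close> in \<open>Q\<close> for
  \<open>anchored_to\<close>.\<close>

lemma component_anchored:
  assumes reach: "\<And>c w. w \<in> W - {c} \<Longrightarrow> \<exists>v. con (W - {c}) w v \<and> (v \<in> nb S \<or> v \<in> Q)"
    and K: "K = component (W - Q) a"
  shows "anchored K (S \<union> Q)"
  unfolding anchored_def
proof (intro allI ballI)
  fix c w assume w: "w \<in> K - {c}"
  then have "w \<in> W - {c}" using component_subset[of "W - Q" a] K by blast
  from reach[OF this] obtain v where v: "con (W - {c}) w v" "v \<in> nb S \<or> v \<in> Q" by blast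
  from first_exit[OF v(1) w] show "\<exists>v\<in>nb (S \<union> Q). con (K - {c}) w v"
  proof
    assume "con (K - {c}) w v"
    moreover from con_in[OF this] have "v \<notin> Q"
      using component_subset[of "W - Q" a] K by blast
    ultimately show ?thesis using v(2) by auto
  next
    assume "\<exists>u u'. con (K - {c}) w u \<and> E u u' \<and> u' \<in> W - {c} - (K - {c})"
    then obtain u u' where u: "con (K - {c}) w u" "E u u'" "u' \<in> W" "u' \<notin> K" by blast
    have "u' \<in> Q"
      using component_exit[of u "W - Q" a u'] con_in[OF u(1)] u K by blast
    then have "u \<in> nb Q" using E_sym[OF u(2)] by (auto simp: nb_iff)
    then show ?thesis using u(1) by auto
  qed
qed

lemma component_adjacent:
  assumes "connected W" "x \<in> W - Q" "y \<in> Q \<inter> W"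
  obtains u u' where "u \<in> component (W - Q) x" "u' \<in> Q \<inter> W" "E u' u"
proof -
  have x: "x \<in> component (W - Q) x" using component_self assms(2) by blast
  have "con W x y" using assms by (auto simp: connected_def)
  moreover have "\<not> con (component (W - Q) x) x y"
    using con_in[of "component (W - Q) x" x y] component_subset[of "W - Q" x] assms(3) by blast
  ultimately obtain u u' where u: "con (component (W - Q) x) x u" "E u u'" "u' \<in> W - component (W - Q) x"
    using first_exit[OF _ x] by blast
  then have "u \<in> component (W - Q) x" using con_in by blast
  moreover have "u' \<in> Q"
    using component_exit[of u "W - Q" x u'] calculation u by blast
  ultimately show ?thesis using that E_sym[OF u(2)] u(3) by blast
qed

text \<open>\<open>A\<close> and \<open>B\<close> are contracted to two separate vertices: jumps are
  allowed within the neighbourhood of either side, not from one to the other.\<close>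

definition link2 :: "'a set \<Rightarrow> 'a set \<Rightarrow> 'a \<Rightarrow> 'a \<Rightarrow> bool" where
  "link2 A B x y \<longleftrightarrow> adj2 x y \<or> x \<in> nb A \<and> y \<in> nb A \<or> x \<in> nb B \<and> y \<in> nb B"

lemma symp_link2: "symp (link2 A B)"
  using adj2_sym by (auto simp: symp_def link2_def)

text \<open>A path through \<open>W\<close> is fixed, the components of its complement are covered by induction and
  their lists are broken into pieces between the path vertices; the path vertices are then inserted
  so that the pieces form an Eulerian multigraph. An open trail gives one list, a closed one two.\<close>

lemma two_sided_cover:
  assumes "finite W" "W \<noteq> {}" "connected W" "anchored W (A \<union> B)" "nb A \<inter> W \<noteq> {}" "nb B \<inter> W \<noteq> {}"
  shows "\<exists>ts. ts \<noteq> [] \<and> distinct (concat ts) \<and> set (concat ts) = W \<and>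
    (\<forall>T\<in>set ts. T \<noteq> [] \<and> hd T \<in> nb A \<and> last T \<in> nb B \<and> successively (link2 A B) T)"
  using assms
proof (induction "card W" arbitrary: W A B rule: less_induct)
  case less
  obtain a b where ab: "a \<in> nb A \<inter> W" "b \<in> nb B \<inter> W" using less.prems(5,6) by blast
  then have "con W a b" using less.prems(3) by (auto simp: connected_def)
  from con_path[OF this] obtain qs where qs: "qs \<noteq> []" "hd qs = a" "last qs = b" "distinct qs"
    "set qs \<subseteq> W" "successively E qs" by blast
  show ?case
  proof (cases "W = set qs")
    case True
    have "successively (link2 A B) qs"
      using qs(6) by (rule successively_mono) (auto simp: link2_def adj2_def)
    then show ?thesis using True qs ab by (intro exI[of _ "[qs]"]) auto
  next
    case False
    define m where "m = length qs"
    define q where "q = (\<lambda>k. qs ! (k - 1))"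
    \<comment> \<open>An inner label stands for the closed neighbourhood of its path vertex, whose
      members are pairwise within distance 2; \<open>0\<close> and \<open>m + 1\<close> stand for
      the two sides.\<close>
    define N where "N l = (if l = 0 then nb A else if l \<le> m then insert (q l) (nb {q l}) else nb B)" for l
    define U where "U = W - set qs"
    define \<K> where "\<K> = component U ` U"
    let ?R = "link2 A B"
    have "1 \<le> m" using qs(1) by (cases qs) (auto simp: m_def)
    have q_map: "map q [1..<m + 1] = qs"
      using map_nth_shift[of qs] by (simp only: q_def m_def)
    have q_in: "q k \<in> set qs" if "k \<in> {1..m}" for k
      using that by (auto simp: q_def m_def)
    have q_E: "E (q k) (q (k + 1))" if "1 \<le> k" "k < m" for k
      using successively_nth[OF qs(6), of "k - 1"] that by (simp add: q_def m_def)
    have q_surj: "\<exists>k\<in>{1..m}. x = q k" if "x \<in> set qs" for x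
    proof -
      have "x \<in> q ` set [1..<m + 1]" using that q_map by (metis set_map)
      then show ?thesis by auto
    qed
    have q_first: "q 1 \<in> nb A" and q_last: "q m \<in> nb B"
      using ab qs(1-3) by (auto simp: q_def m_def hd_conv_nth last_conv_nth)
    have cl: "cliques N ?R"
      unfolding cliques_def
    proof (intro allI ballI impI)
      fix l x y assume *: "x \<in> N l" "y \<in> N l" "x \<noteq> y"
      consider "l = 0" | "1 \<le> l" "l \<le> m" | "m < l" by linarith
      then show "?R x y"
      proof cases
        case 2
        then have "x = q l \<or> E (q l) x" "y = q l \<or> E (q l) y"
          using * by (auto simp: N_def)
        then have "adj2 x y" using * E_sym[of "q l" x] by (auto simp: adj2_def)
        then show ?thesis by (simp add: link2_def)
      qed (use * in \<open>auto simp: N_def link2_def\<close>)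
    qed
    have q_N: "q k \<in> N l" if kl: "k \<in> {1..m}" "l \<in> {k - 1, k, k + 1}" for k l
    proof -
      consider "l = k - 1" "k = 1" | "l = k - 1" "1 < k" | "l = k" | "l = k + 1" "k = m"
        | "l = k + 1" "k < m" using kl by fastforce
      then show ?thesis
      proof cases
        case 2
        then show ?thesis using q_E[of l] that by (auto simp: N_def)
      next
        case 5
        then show ?thesis using E_sym[OF q_E[of k]] that by (auto simp: N_def)
      qed (use that q_first q_last in \<open>auto simp: N_def\<close>)
    qed
    have finU: "finite U" using less.prems(1) by (simp add: U_def)
    have reach: "\<exists>v. con (W - {c}) w v \<and> (v \<in> nb (A \<union> B) \<or> v \<in> set qs)" if "w \<in> W - {c}" for c w
      using less.prems(4) that unfolding anchored_def by blast
    have pieces: "\<exists>M. content M = mset_set K \<and>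
        (\<forall>p\<in>#M. piece_ok N ?R p \<and> fst p \<le> m + 1 \<and> snd (snd p) \<le> m + 1) \<and>
        (True \<longrightarrow> (\<exists>p\<in>#M. fst p \<in> {1..m} \<and> snd (snd p) \<noteq> fst p))" if K: "K \<in> \<K>" for K
    proof -
      obtain x where x: "x \<in> U" "K = component U x" using K by (auto simp: \<K>_def)
      obtain u u' where u: "u \<in> K" "u' \<in> set qs" "E u' u"
        using component_adjacent[OF less.prems(3), of x "set qs" a] x qs(1,2,5) ab
        unfolding U_def by (metis Int_iff hd_in_set)
      obtain i where i: "i \<in> {1..m}" "u' = q i" using q_surj[OF u(2)] by blast
      \<comment> \<open>The component gets the single path vertex \<open>q i\<close> as one side and
        everything else as the other, so that each list starts at the label \<open>i\<close> and can
        end at a different one.\<close>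
      define B' where "B' = A \<union> B \<union> (set qs - {q i})"
      have KW: "K \<subseteq> W" "K \<inter> set qs = {}" "finite K"
        using component_subset[of U x] x finU finite_subset by (auto simp: U_def)
      have "a \<in> W" "a \<notin> K"
        using ab KW(2) qs(1,2) hd_in_set[OF qs(1)] by auto
      then have cardK: "card K < card W"
        using KW(1) less.prems(1) by (metis psubsetI psubset_card_mono)
      have blkK: "anchored K ({q i} \<union> B')"
      proof -
        have "{q i} \<union> B' = A \<union> B \<union> set qs" using q_in[OF i(1)] by (auto simp: B'_def)
        then show ?thesis using component_anchored[of W "A \<union> B" "set qs" K x] reach x by (simp add: U_def)
      qed
      \<comment> \<open>With \<open>q i\<close> deleted, the anchoring of \<open>W\<close> shows
        that \<open>K\<close> has another way out.\<close>
      have nbB': "nb B' \<inter> K \<noteq> {}"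
      proof -
        have "q i \<notin> K" using q_in[OF i(1)] KW(2) by blast
        then have uK: "u \<in> W - {q i}" "u \<in> K" using u(1) KW(1) by auto
        from less.prems(4) uK(1) obtain v where v: "v \<in> nb (A \<union> B)" "con (W - {q i}) u v"
          unfolding anchored_def by blast
        from first_exit[OF v(2) uK(2)] show ?thesis
        proof
          assume "con K u v"
          then show ?thesis using v(1) con_in[of K u v] by (auto simp: B'_def)
        next
          assume "\<exists>y y'. con K u y \<and> E y y' \<and> y' \<in> W - {q i} - K"
          then obtain y y' where y: "con K u y" "E y y'" "y' \<in> W - {q i} - K" by blast
          have "y \<in> K" using con_in[OF y(1)] by simp
          moreover have "y' \<in> set qs"
            using component_exit[of y U x y'] calculation y x by (auto simp: U_def)
          ultimately have "y \<in> nb B' \<inter> K" using E_sym[OF y(2)] y(3) by (auto simp: B'_def nb_iff)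
          then show ?thesis by blast
        qed
      qed
      have "connected K" using connected_component x by simp
      moreover have "K \<noteq> {}" "nb {q i} \<inter> K \<noteq> {}" using u i(2) by auto
      ultimately obtain ts where ts: "ts \<noteq> []" "distinct (concat ts)" "set (concat ts) = K"
        "\<And>T. T \<in> set ts \<Longrightarrow> T \<noteq> [] \<and> hd T \<in> nb {q i} \<and> last T \<in> nb B' \<and> successively (link2 {q i} B') T"
        using less.hyps[OF cardK KW(3) _ _ blkK _ nbB'] by blast
      define J where "J = {..m + 1} - {i}"
      have labels: "\<exists>l\<in>J. x \<in> N l" if "x \<in> nb B'" for x
      proof -
        from that consider "x \<in> nb A" | "x \<in> nb B" | y where "y \<in> set qs" "y \<noteq> q i" "E y x"
          by (auto simp: B'_def nb_iff)
        then show ?thesis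
        proof cases
          case 1
          then show ?thesis using i(1) by (intro bexI[of _ 0]) (auto simp: N_def J_def)
        next
          case 2
          then show ?thesis using i(1) by (intro bexI[of _ "m + 1"]) (auto simp: N_def J_def)
        next
          case 3
          then obtain k where "k \<in> {1..m}" "y = q k" using q_surj by blast
          then show ?thesis using 3 by (intro bexI[of _ k]) (auto simp: N_def J_def)
        qed
      qed
      have T: "T \<noteq> [] \<and> successively (\<lambda>x y. ?R x y \<or> x \<in> nb B' \<and> y \<in> nb B') T \<and> hd T \<in> N i \<and>
          (\<exists>b\<in>J. last T \<in> N b)" if "T \<in> set ts" for T
      proof (intro conjI)
        \<comment> \<open>Two neighbours of the single vertex \<open>q i\<close> are within distance
          2 anyway, so only jumps inside \<open>nb B'\<close> may need breaking.\<close>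
        show "successively (\<lambda>x y. ?R x y \<or> x \<in> nb B' \<and> y \<in> nb B') T"
          using ts(4)[OF that] adj2_common
          by (auto elim!: successively_mono simp: link2_def simp del: nb_single)
        show "hd T \<in> N i" using ts(4)[OF that] i(1) by (auto simp: N_def)
      qed (use ts(4)[OF that] labels in auto)
      obtain M where M: "content M = mset (concat ts)"
        "\<forall>p\<in>#M. piece_ok N ?R p \<and> fst p \<in> insert i J \<and> snd (snd p) \<in> J"
        "\<exists>p\<in>#M. fst p = i \<and> snd (snd p) \<noteq> i"
        using break_lists[of ts ?R "nb B'" N i J, OF T labels] ts(1) J_def by blast
      have "content M = mset_set K"
        using M(1) ts(2,3) mset_set_set[OF ts(2)] by simp
      then show ?thesis using M(2,3) i(1) unfolding J_def by (intro exI[of _ M]) auto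
    qed
    obtain M where M: "content M = mset_set (\<Union>\<K>)"
      "\<forall>p\<in>#M. piece_ok N ?R p \<and> fst p \<le> m + 1 \<and> snd (snd p) \<le> m + 1"
      "(\<exists>K\<in>\<K>. True) \<longrightarrow> (\<exists>p\<in>#M. fst p \<in> {1..m} \<and> snd (snd p) \<noteq> fst p)"
    proof -
      have fin: "finite K" if "K \<in> \<K>" for K
        using that finite_subset[OF component_subset finU] by (auto simp: \<K>_def)
      have "finite \<K>" "pairwise disjnt \<K>"
        using finU components_disjoint[of U] by (simp_all add: \<K>_def)
      from collect_pieces[OF this fin pieces] show ?thesis using that by blast
    qed
    have "U \<noteq> {}" using False qs(5) by (auto simp: U_def)
    then have "\<exists>K\<in>\<K>. True" by (auto simp: \<K>_def)
    with M(3) obtain p where p: "p \<in># M" "fst p \<in> {1..m}" "snd (snd p) \<noteq> fst p" by blast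
    have bM: "labels_le (m + 1) M" using M(2) by (auto simp: labels_le_def)
    obtain Q where Q: "spine q 1 (m + 1) Q" "\<And>l. l \<in> {1..m} \<Longrightarrow> even (deg l (M + Q))"
      "linked (M + Q)" "deg 0 (M + Q) \<noteq> 0" "deg (m + 1) (M + Q) \<noteq> 0"
      using spine_exists[OF bM \<open>1 \<le> m\<close> p(2,1) refl p(3), of q] by blast
    have ok: "piece_ok N ?R p" if "p \<in># M + Q" for p
    proof -
      have "p \<in># M \<or> p \<in># Q" using that by simp
      then show ?thesis
      proof
        assume "p \<in># Q"
        from spine_mem[OF Q(1) this] obtain k x y where k: "1 \<le> k" "k < m + 1" "p = (x, [q k], y)"
          "x \<in> {k - 1, k, k + 1}" "y \<in> {k - 1, k, k + 1}" by blast
        then show ?thesis using q_N[of k x] q_N[of k y] by (simp add: piece_ok_def)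
      qed (use M(2) in blast)
    qed
    have contMQ: "content (M + Q) = mset_set W"
    proof -
      have "\<Union>\<K> = U" using Union_components by (simp add: \<K>_def)
      then have "content (M + Q) = mset_set U + mset_set (set qs)"
        using M(1) spine_cont[OF Q(1)] mset_set_set[OF qs(4)] q_map by (simp del: upt_Suc mset_map)
      also have "\<dots> = mset_set (U \<union> set qs)"
        using finU by (subst mset_set_Union) (auto simp: U_def)
      also have "U \<union> set qs = W" using qs(5) by (auto simp: U_def)
      finally show ?thesis .
    qed
    have bMQ: "labels_le (m + 1) (M + Q)" using bM spine_bounded[OF Q(1)] by simp
    have "even (\<Sum>l\<in>UNIV \<inter> {..m + 1}. deg l (M + Q))"
      by (rule even_sum_deg_closed) (use bMQ in \<open>simp_all add: closed_under_def\<close>)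
    moreover have "even (\<Sum>l\<in>UNIV \<inter> {..m + 1}. deg l (M + Q)) \<longleftrightarrow>
        even (\<Sum>l\<in>{0, m + 1}. deg l (M + Q))"
    proof (rule even_sum_subset)
      fix l assume "l \<in> UNIV \<inter> {..m + 1} - {0, m + 1}"
      then have "l \<in> {1..m}" by auto
      then show "even (deg l (M + Q))" by (rule Q(2))
    qed auto
    ultimately have par: "even (deg 0 (M + Q)) \<longleftrightarrow> even (deg (m + 1) (M + Q))"
      by (simp del: deg_simps)
    have N_ends: "N 0 = nb A" "N (m + 1) = nb B" by (simp_all add: N_def)
    have even_mid: "even (deg l (M + Q))" if "l \<noteq> 0" "l \<noteq> m + 1" for l
    proof (cases "l \<le> m")
      case True
      then show ?thesis using Q(2)[of l] that by simp
    next
      case False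
      then show ?thesis using labels_le_deg[OF bMQ, of l] that by simp
    qed
    show ?thesis
    proof (cases "even (deg 0 (M + Q))")
      case False
      then have odd: "odd (deg 0 (M + Q))" "odd (deg (m + 1) (M + Q))" using par by blast+
      have "0 \<noteq> m + 1" by simp
      from assemble_open[OF ok symp_link2 cl contMQ less.prems(1) even_mid odd Q(3) this]
      obtain L where "L \<noteq> []" "distinct L" "set L = W" "hd L \<in> N 0" "last L \<in> N (m + 1)"
        "successively ?R L" by blast
      then show ?thesis unfolding N_ends by (intro exI[of _ "[L]"]) simp
    next
      \<comment> \<open>All degrees are even: the closed trail is cut at both end labels, and the
        half running from \<open>B\<close> back to \<open>A\<close> is reversed.\<close>
      case True
      then have even: "even (deg l (M + Q))" for l
        using par even_mid[of l] by (cases "l = 0"; cases "l = m + 1") (simp_all del: deg_simps)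
      have "0 \<noteq> m + 1" by simp
      from assemble_closed[OF ok symp_link2 cl contMQ less.prems(1) even Q(3-5) this]
      obtain L1 L2 where L: "L1 \<noteq> []" "L2 \<noteq> []" "distinct (L1 @ L2)" "set (L1 @ L2) = W"
        "hd L1 \<in> N 0" "last L1 \<in> N (m + 1)" "successively ?R L1"
        "hd L2 \<in> N (m + 1)" "last L2 \<in> N 0" "successively ?R L2" by blast
      have "(\<lambda>x y. ?R y x) = ?R" using symp_link2[of A B] by (auto simp: symp_def)
      then have "successively ?R (rev L2)" using L(10) by (simp only: successively_rev)
      then show ?thesis using L unfolding N_ends
        by (intro exI[of _ "[L1, rev L2]"]) (simp add: hd_rev last_rev)
    qed
  qed
qed

end

section \<open>Hamiltonian lists with a prescribed edge\<close>

lemma sublist_join: "xs \<noteq> [] \<Longrightarrow> ys \<noteq> [] \<Longrightarrow> sublist [last xs, hd ys] (xs @ ys)"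
  by (cases xs rule: rev_cases; cases ys) (auto intro: sublist_appendI[of "[_, _]", simplified])

context sgraph
begin

definition route :: "'a set \<Rightarrow> 'a set \<Rightarrow> 'a \<Rightarrow> 'a list \<Rightarrow> bool" where
  "route W S z L \<longleftrightarrow> L \<noteq> [] \<and> distinct L \<and> set L = W \<and> hd L \<in> nb S \<and> last L = z \<and>
     successively (link S) L"

text \<open>The induction hypothesis as a predicate, so that each case of the induction can be a
  lemma of its own.\<close>

definition solved :: "nat \<Rightarrow> bool" where
  "solved n \<longleftrightarrow> (\<forall>W S z t. card W < n \<longrightarrow> finite W \<longrightarrow> t \<in> W \<longrightarrow> t \<noteq> z \<longrightarrow> anchored_to W S z \<longrightarrow>
     (\<exists>L. route W S z L \<and> edge_at t L))"

lemma symp_link: "symp (link S)"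
  using adj2_sym by (auto simp: symp_def link_def)

lemma E_link: "E x y \<Longrightarrow> link S x y"
  by (simp add: link_def adj2_def)

lemma adj2_link: "adj2 x y \<Longrightarrow> link S x y"
  by (simp add: link_def)

text \<open>Where no edge is prescribed, any vertex other than \<open>z\<close> can serve as
  \<open>t\<close>; the case \<open>W = {z}\<close> has to be supplied separately.\<close>

lemma solved_route:
  assumes "solved n" "card W < n" "finite W" "anchored_to W S z" "W = {z} \<Longrightarrow> z \<in> nb S"
  obtains L where "route W S z L"
proof (cases "W = {z}")
  case True
  then show ?thesis using assms(5) that[of "[z]"] by (simp add: route_def)
next
  case False
  moreover have "z \<in> W" using assms(4) by (simp add: anchored_to_def)
  ultimately obtain t where "t \<in> W" "t \<noteq> z" by blast
  then show ?thesis using assms(1-4) that unfolding solved_def by meson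
qed

text \<open>The part \<open>Z\<close> behind \<open>t\<close> is entered from the rest of
  \<open>W\<close> only through \<open>t\<close>, and \<open>S\<close> has no neighbour in it except
  possibly \<open>z\<close>. So \<open>W - Z\<close> is listed up to \<open>t\<close>, and
  \<open>Z\<close> from a neighbour of \<open>t\<close> on; the junction is the required
  edge.\<close>

lemma main_separated:
  assumes "solved (card W)" "finite W" "t \<in> W" "t \<noteq> z" "anchored_to W S z"
    and sep: "component (W - {t}) z \<inter> nb S \<subseteq> {z}"
  shows "\<exists>L. route W S z L \<and> edge_at t L"
proof -
  define Z where "Z = component (W - {t}) z"
  have zW: "z \<in> W" and W: "connected W"
    and reach: "\<And>c w. w \<in> W - {c} \<Longrightarrow> \<exists>v. con (W - {c}) w v \<and> (v \<in> nb S \<or> v = z)"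
    using assms(5) by (auto simp: anchored_to_def)
  have zZ: "z \<in> Z" using component_self[of z "W - {t}"] zW assms(4) by (simp add: Z_def)
  have ZW: "Z \<subseteq> W" "t \<notin> Z" using component_subset[of "W - {t}" z] by (auto simp: Z_def)
  have exit: "y \<in> Z" if "x \<in> Z" "E x y" "y \<in> W" "y \<noteq> t" for x y
    using component_exit[of x "W - {t}" z y] that by (simp add: Z_def)
  have enter: "x = t" if "x \<in> W - Z" "E x y" "y \<in> Z" for x y
    using exit[OF that(3) E_sym[OF that(2)]] that by blast
  have stay: "con (W - Z - {c}) w v \<or> con (W - Z - {c}) w t"
    if wv: "w \<in> W - Z - {c}" "con (W - {c}) w v" for c w v
  proof (cases "con (W - Z - {c}) w v")
    case False
    then obtain u u' where u: "con (W - Z - {c}) w u" "E u u'" "u' \<in> W - {c} - (W - Z - {c})"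
      using first_exit[OF wv(2,1)] by blast
    then have "u = t" using enter[of u u'] con_in[OF u(1)] by blast
    then show ?thesis using u(1) by simp
  qed simp
  have chn1: "anchored_to (W - Z) S t"
    unfolding anchored_to_def
  proof (intro conjI allI ballI)
    have toT: "con (W - Z) w t" if "w \<in> W - Z" for w
    proof -
      have "con W w t" using W that assms(3) by (auto simp: connected_def)
      from first_exit[OF this that] show ?thesis
        using enter con_in by (metis DiffD1 DiffD2 DiffI)
    qed
    show "connected (W - Z)"
      unfolding connected_def using toT con_sym con_trans by meson
    show "t \<in> W - Z" using ZW assms(3) by simp
  next
    fix c w assume w: "w \<in> W - Z - {c}"
    then obtain v where v: "con (W - {c}) w v" "v \<in> nb S \<or> v = z" using reach[of w c] by blast
    from stay[OF w v(1)] show "\<exists>v. con (W - Z - {c}) w v \<and> (v \<in> nb S \<or> v = t)"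
      using v(2) con_in zZ by (metis DiffD1 DiffD2)
  qed
  have chn2: "anchored_to Z {t} z"
    unfolding anchored_to_def
  proof (intro conjI allI ballI)
    show "connected Z" using connected_component by (simp add: Z_def)
    show "z \<in> Z" by (rule zZ)
    fix c w assume w: "w \<in> Z - {c}"
    then obtain v where v: "con (W - {c}) w v" "v \<in> nb S \<or> v = z" using reach[of w c] ZW by blast
    from first_exit[OF v(1) w] show "\<exists>v. con (Z - {c}) w v \<and> (v \<in> nb {t} \<or> v = z)"
    proof
      assume "con (Z - {c}) w v"
      moreover from this have "v \<in> Z" using con_in by blast
      ultimately show ?thesis using v(2) sep by (auto simp: Z_def)
    next
      assume "\<exists>u u'. con (Z - {c}) w u \<and> E u u' \<and> u' \<in> W - {c} - (Z - {c})"
      then obtain u u' where u: "con (Z - {c}) w u" "E u u'" "u' \<in> W" "u' \<notin> Z" by blast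
      then have "u' = t" using exit[of u u'] con_in[OF u(1)] by blast
      then have "u \<in> nb {t}" using E_sym[OF u(2)] by simp
      then show ?thesis using u(1) by blast
    qed
  qed
  have card: "card (W - Z) < card W" "card Z < card W"
    using zZ ZW zW assms(2,3) by (auto intro!: psubset_card_mono)
  \<comment> \<open>With \<open>z\<close> deleted, \<open>t\<close> still reaches a neighbour of
    \<open>S\<close>; this lies outside \<open>Z\<close> and is therefore \<open>t\<close>
    itself.\<close>
  have "t \<in> nb S" if "W - Z = {t}"
  proof -
    obtain v where v: "con (W - {z}) t v" "v \<in> nb S \<or> v = z"
      using reach[of t z] assms(3,4) by blast
    have "v \<noteq> z" using con_in[OF v(1)] by blast
    then have "v \<in> nb S" "v \<in> W" "v \<notin> Z"
      using v con_in[OF v(1)] sep by (auto simp: Z_def)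
    then show ?thesis using that by (metis DiffI singletonD)
  qed
  then obtain L1 where L1: "route (W - Z) S t L1"
    using solved_route[OF assms(1) card(1) _ chn1] assms(2) by blast
  have "z \<in> nb {t}" if "Z = {z}"
  proof -
    have "con W z t" using W zW assms(3) by (auto simp: connected_def)
    moreover have "\<not> con Z z t" using con_in ZW by blast
    ultimately obtain u u' where u: "con Z z u" "E u u'" "u' \<in> W - Z"
      using first_exit[OF _ zZ] by blast
    then have "u \<in> Z" using con_in by blast
    then have "u = z" "u' = t" using that exit[of u u'] u by auto
    then show ?thesis using E_sym[OF u(2)] by simp
  qed
  then obtain L2 where L2: "route Z {t} z L2"
    using solved_route[OF assms(1) card(2) finite_subset[OF ZW(1) assms(2)] chn2] by blast
  have tL2: "E t (hd L2)" using L2 by (simp add: route_def)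
  have "route W S z (L1 @ L2)"
    unfolding route_def
  proof (intro conjI)
    have "successively (link S) L2"
      using L2 unfolding route_def by (auto elim!: successively_mono intro: adj2_link)
    then show "successively (link S) (L1 @ L2)"
      using L1 E_link[OF tL2] by (simp add: route_def successively_append_iff)
  qed (use L1 L2 ZW in \<open>auto simp: route_def\<close>)
  moreover have "edge_at t (L1 @ L2)"
    using sublist_join[of L1 L2] L1 L2 tL2 unfolding edge_at_def route_def by blast
  ultimately show ?thesis by blast
qed

text \<open>Each further list is traversed forwards or backwards according to the side on which the
  previous ones ended.\<close>

lemma alternate:
  assumes "\<And>T. T \<in> set ts \<Longrightarrow> T \<noteq> [] \<and> hd T \<in> nb A \<and> last T \<in> nb B \<and> successively (link2 A B) T"
  shows "\<exists>L. mset L = mset (concat ts) \<and> successively (link2 A B) L \<and>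
    (L \<noteq> [] \<longrightarrow> hd L \<in> nb A \<and> (last L \<in> nb A \<or> last L \<in> nb B))"
  using assms
proof (induction ts rule: rev_induct)
  case Nil
  show ?case by simp
next
  case (snoc T ts)
  obtain L where L: "mset L = mset (concat ts)" "successively (link2 A B) L"
    "L \<noteq> [] \<longrightarrow> hd L \<in> nb A \<and> (last L \<in> nb A \<or> last L \<in> nb B)"
    using snoc.IH snoc.prems by auto
  have T: "T \<noteq> []" "hd T \<in> nb A" "last T \<in> nb B" "successively (link2 A B) T"
    using snoc.prems[of T] by auto
  have "(\<lambda>x y. link2 A B y x) = link2 A B" using symp_link2[of A B] by (auto simp: symp_def)
  then have revT: "successively (link2 A B) (rev T)" using T(4) by (simp only: successively_rev)
  show ?case
  proof (cases "L = [] \<or> last L \<in> nb A")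
    case True
    then show ?thesis
      using L T by (intro exI[of _ "L @ T"])
        (auto simp: successively_append_iff link2_def hd_append)
  next
    case False
    then show ?thesis
      using L T revT by (intro exI[of _ "L @ rev T"])
        (auto simp: successively_append_iff link2_def hd_append hd_rev last_rev simp del: successively_rev)
  qed
qed

text \<open>The only possible edge is \<open>tz\<close>, so the list must end with
  \<open>t, z\<close>. The rest is covered by lists between \<open>S\<close> and \<open>z\<close>;
  on whichever side their concatenation ends, it can step to \<open>t\<close>, which is a neighbour
  of both.\<close>

lemma main_pendant:
  assumes "finite W" "t \<in> W" "t \<noteq> z" "anchored_to W S z" and pend: "nb {t} \<inter> (W - {z}) = {}"
  shows "\<exists>L. route W S z L \<and> edge_at t L"
proof -
  have zW: "z \<in> W" and W: "connected W"
    and reach: "\<And>c w. w \<in> W - {c} \<Longrightarrow> \<exists>v. con (W - {c}) w v \<and> (v \<in> nb S \<or> v = z)"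
    using assms(4) by (auto simp: anchored_to_def)
  have only_z: "y = z" if "E t y" "y \<in> W" for y using pend that by auto
  have "E t z"
  proof -
    have "con W t z" using W zW assms(2) by (auto simp: connected_def)
    then obtain u u' where u: "con {t} t u" "E u u'" "u' \<in> W - {t}"
      using first_exit[of W t z "{t}"] con_in[of "{t}" t z] assms(3) by blast
    then have "u = t" using con_in by blast
    then show ?thesis using u only_z by blast
  qed
  have t_nb: "t \<in> nb S"
  proof -
    obtain v where v: "con (W - {z}) t v" "v \<in> nb S \<or> v = z"
      using reach[of t z] assms(2,3) by blast
    have "con {t} t v"
    proof (rule ccontr)
      assume "\<not> con {t} t v"
      then obtain u u' where u: "con {t} t u" "E u u'" "u' \<in> W - {z} - {t}"
        using first_exit[OF v(1), of "{t}"] by blast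
      then have "u = t" using con_in by blast
      then show False using u only_z by blast
    qed
    then have "v = t" using con_in by blast
    then show ?thesis using v(2) assms(3) by blast
  qed
  define U where "U = W - {t, z}"
  have cover: "\<exists>ts. distinct (concat ts) \<and> set (concat ts) = D \<and>
      (\<forall>T\<in>set ts. T \<noteq> [] \<and> hd T \<in> nb S \<and> last T \<in> nb {z} \<and> successively (link2 S {z}) T)"
    if D: "D \<in> component U ` U" for D
  proof -
    obtain x where x: "x \<in> U" "D = component U x" using D by blast
    have D: "D \<subseteq> U" "finite D" "x \<in> D"
      using component_subset[of U x] x assms(1) finite_subset component_self by (auto simp: U_def)
    \<comment> \<open>\<open>t\<close> has no neighbour in \<open>U\<close>, so a component of
      \<open>U\<close> can be left within \<open>W\<close> only through \<open>z\<close>.\<close>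
    have exit: "y \<in> D \<or> y = z" if "u \<in> D" "E u y" "y \<in> W" for u y
    proof -
      have "y \<noteq> t" using only_z[of u] E_sym[OF that(2)] that(1) D(1) by (auto simp: U_def)
      then show ?thesis using component_exit[of u U x y] that x by (auto simp: U_def)
    qed
    have blkD: "anchored D (S \<union> {z})"
      unfolding anchored_def
    proof (intro allI ballI)
      fix c w assume w: "w \<in> D - {c}"
      then obtain v where v: "con (W - {c}) w v" "v \<in> nb S \<or> v = z"
        using reach[of w c] D(1) by (auto simp: U_def)
      from first_exit[OF v(1) w] show "\<exists>v\<in>nb (S \<union> {z}). con (D - {c}) w v"
      proof
        assume "con (D - {c}) w v"
        moreover from con_in[OF this] have "v \<noteq> z" using D(1) by (auto simp: U_def)
        moreover from this v(2) have "v \<in> nb (S \<union> {z})" by (auto simp: nb_iff)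
        ultimately show ?thesis by blast
      next
        assume "\<exists>u u'. con (D - {c}) w u \<and> E u u' \<and> u' \<in> W - {c} - (D - {c})"
        then obtain u u' where u: "con (D - {c}) w u" "E u u'" "u' \<in> W" "u' \<notin> D" by blast
        then have "u' = z" using exit[of u u'] con_in[OF u(1)] by blast
        then have "u \<in> nb (S \<union> {z})" using E_sym[OF u(2)] by (simp add: nb_iff)
        then show ?thesis using u(1) by blast
      qed
    qed
    have "nb S \<inter> D \<noteq> {}"
    proof -
      obtain v where v: "con (W - {z}) x v" "v \<in> nb S \<or> v = z"
        using reach[of x z] x(1) by (auto simp: U_def)
      have "con D x v"
      proof (rule ccontr)
        assume "\<not> con D x v"
        then obtain u u' where u: "con D x u" "E u u'" "u' \<in> W - {z} - D"
          using first_exit[OF v(1) D(3)] by blast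
        then show False using exit[of u u'] con_in[OF u(1)] by blast
      qed
      then have "v \<in> D" using con_in by blast
      then show ?thesis using v(2) D(1) by (auto simp: U_def)
    qed
    moreover have "nb {z} \<inter> D \<noteq> {}"
    proof -
      have "con W x z" using W x zW by (auto simp: connected_def U_def)
      moreover have "\<not> con D x z" using con_in[of D x z] D(1) by (auto simp: U_def)
      ultimately obtain u u' where u: "con D x u" "E u u'" "u' \<in> W - D"
        using first_exit[OF _ D(3)] by blast
      then have "u \<in> D" "u' = z" using exit[of u u'] con_in[OF u(1)] by blast+
      then show ?thesis using E_sym[OF u(2)] by auto
    qed
    ultimately show ?thesis
      using two_sided_cover[OF D(2) _ _ blkD] connected_component[of U x] D(3) x(2) by blast
  qed
  have "\<exists>ts. distinct (concat ts) \<and> set (concat ts) = \<Union>\<D> \<and>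
      (\<forall>T\<in>set ts. T \<noteq> [] \<and> hd T \<in> nb S \<and> last T \<in> nb {z} \<and> successively (link2 S {z}) T)"
    if "finite \<D>" "\<D> \<subseteq> component U ` U" for \<D>
    using that
  proof (induction \<D> rule: finite_induct)
    case empty
    show ?case by (intro exI[of _ "[]"]) simp
  next
    case (insert D \<D>)
    obtain ts ts' where
      "distinct (concat ts)" "set (concat ts) = \<Union>\<D>"
      "\<forall>T\<in>set ts. T \<noteq> [] \<and> hd T \<in> nb S \<and> last T \<in> nb {z} \<and> successively (link2 S {z}) T"
      "distinct (concat ts')" "set (concat ts') = D"
      "\<forall>T\<in>set ts'. T \<noteq> [] \<and> hd T \<in> nb S \<and> last T \<in> nb {z} \<and> successively (link2 S {z}) T"
      using insert.IH insert.prems cover[of D] by auto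
    moreover have "D \<inter> \<Union>\<D> = {}"
    proof -
      have "D \<inter> D' = {}" if "D' \<in> \<D>" for D'
        using pairwiseD[OF components_disjoint[of U], of D D'] that insert.prems insert.hyps(2)
        by (auto simp: disjnt_def)
      then show ?thesis by blast
    qed
    ultimately show ?case by (intro exI[of _ "ts' @ ts"]) auto
  qed
  from this[of "component U ` U"] obtain ts where ts: "distinct (concat ts)" "set (concat ts) = U"
    "\<forall>T\<in>set ts. T \<noteq> [] \<and> hd T \<in> nb S \<and> last T \<in> nb {z} \<and> successively (link2 S {z}) T"
    using assms(1) Union_components[of U] by (auto simp: U_def)
  obtain L where L: "mset L = mset (concat ts)" "successively (link2 S {z}) L"
    "L \<noteq> [] \<longrightarrow> hd L \<in> nb S \<and> (last L \<in> nb S \<or> last L \<in> nb {z})"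
    using alternate[of ts S "{z}"] ts(3) by blast
  have "distinct L" "set L = U"
    using L(1) ts(1,2) mset_eq_imp_distinct_iff mset_eq_setD by metis+
  have "successively (link S) L"
    using L(2) adj2_common by (auto elim!: successively_mono simp: link2_def link_def simp del: nb_single)
  moreover have "link S (last L) t" if "L \<noteq> []"
    using L(3) that t_nb E_sym[OF \<open>E t z\<close>] adj2_common[of "last L" z t] by (auto simp: link_def)
  ultimately have "successively (link S) (L @ [t, z])"
    using E_link[OF \<open>E t z\<close>] by (auto simp: successively_append_iff)
  then have "route W S z (L @ [t, z])"
    using \<open>distinct L\<close> \<open>set L = U\<close> L(3) t_nb zW assms(2,3)
    by (cases "L = []") (auto simp: route_def U_def)
  moreover have "edge_at t (L @ [t, z])"
    using \<open>E t z\<close> sublist_append_leftI[of "[t, z]" L] unfolding edge_at_def by blast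
  ultimately show ?thesis by blast
qed

text \<open>By \<open>cut\<close>, every neighbour of \<open>t\<close> in \<open>W\<close> other
  than \<open>z\<close> lies on the path \<open>rho\<close> from \<open>z\<close> to
  \<open>v0\<close>. The list runs from \<open>S\<close> through \<open>W1\<close> to
  \<open>y\<close>, along the edge to \<open>t\<close>, and from there across \<open>y\<close> into
  \<open>Z\<close>, which is a step at distance 2.\<close>

lemma main_cut_pairs:
  assumes "solved (card W)" "finite W" "t \<in> W" "t \<noteq> z" "anchored_to W S z"
    and v0: "con (W - {t}) z v0" "v0 \<in> nb S" "v0 \<noteq> z"
    and y: "y \<in> W" "y \<noteq> z" "y \<noteq> t" "E t y"
    and cut: "\<And>x v. x \<in> W \<Longrightarrow> x \<noteq> z \<Longrightarrow> x \<noteq> t \<Longrightarrow> E t x \<Longrightarrow> v \<in> nb S \<Longrightarrow> v \<noteq> z \<Longrightarrow> \<not> con (W - {t, x}) v z"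
  shows "\<exists>L. route W S z L \<and> edge_at t L"
proof -
  define Z where "Z = component (W - {t, y}) z"
  define W1 where "W1 = W - Z - {t}"
  have zW: "z \<in> W" and W: "connected W"
    and reach: "\<And>c w. w \<in> W - {c} \<Longrightarrow> \<exists>v. con (W - {c}) w v \<and> (v \<in> nb S \<or> v = z)"
    using assms(5) by (auto simp: anchored_to_def)
  have zZ: "z \<in> Z" using component_self[of z "W - {t, y}"] zW assms(4) y(2) by (simp add: Z_def)
  have ZW: "Z \<subseteq> W" "t \<notin> Z" "y \<notin> Z" using component_subset[of "W - {t, y}" z] by (auto simp: Z_def)
  have yW1: "y \<in> W1" using y ZW by (simp add: W1_def)
  have exit: "x' \<in> Z \<or> x' = t \<or> x' = y" if "x \<in> Z" "E x x'" "x' \<in> W" for x x'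
    using component_exit[of x "W - {t, y}" z x'] that by (auto simp: Z_def)
  obtain rho where rho: "rho \<noteq> []" "hd rho = z" "last rho = v0" "distinct rho"
    "set rho \<subseteq> W - {t}" "successively E rho"
    using con_path[OF v0(1)] by blast
  have in_rho: "x \<in> set rho" if "x \<in> W" "x \<noteq> z" "x \<noteq> t" "E t x" for x
  proof (rule ccontr)
    assume "x \<notin> set rho"
    have "con (set rho) v0 z"
      using path_con[OF rho(6)] rho(1-3) hd_in_set last_in_set by metis
    then have "con (W - {t, x}) v0 z"
      by (rule con_mono) (use rho(5) \<open>x \<notin> set rho\<close> in auto)
    then show False using cut[OF that v0(2,3)] by blast
  qed
  obtain r1 r2 where r: "rho = r1 @ y # r2"
    using in_rho[OF y] by (meson split_list)
  have "r1 \<noteq> []" using r rho(2) y(2) by auto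
  have s1: "successively E r1" "E (last r1) y" and s2: "successively E (y # r2)"
    using rho(6) r \<open>r1 \<noteq> []\<close> by (auto simp: successively_append_iff)
  have hd1: "hd r1 = z" using rho(2) r \<open>r1 \<noteq> []\<close> by simp
  have last2: "last (y # r2) = v0" using rho(3) r by simp
  have d1: "distinct r1" and d2: "distinct (y # r2)" using rho(4) r by auto
  have r1Z: "set r1 \<subseteq> Z"
  proof
    fix x assume "x \<in> set r1"
    then have "con (set r1) z x"
      using path_con[OF s1(1)] hd_in_set[OF \<open>r1 \<noteq> []\<close>] hd1 by metis
    then have "con (W - {t, y}) z x"
      by (rule con_mono) (use rho(4,5) r in auto)
    then show "x \<in> Z" by (simp add: Z_def component_def)
  qed
  have no_nb: "v = z" if "v \<in> Z" "v \<in> nb S" for v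
  proof -
    have "con (W - {t, y}) v z" using that(1) con_sym by (simp add: Z_def component_def)
    then show ?thesis using cut[OF y that(2)] by blast
  qed
  have r2W1: "set (y # r2) \<subseteq> W1"
  proof
    fix x assume x: "x \<in> set (y # r2)"
    have "x \<notin> Z"
    proof
      assume "x \<in> Z"
      then have "x \<in> set r2" using x ZW by auto
      then have "r2 \<noteq> []" by auto
      have "successively E r2" using s2 by (cases r2) auto
      from path_con[OF this \<open>x \<in> set r2\<close> last_in_set[OF \<open>r2 \<noteq> []\<close>]]
      have "con (set r2) x v0" using last2 \<open>r2 \<noteq> []\<close> by simp
      then have "con (W - {t, y}) x v0"
        by (rule con_mono) (use rho(4,5) r in auto)
      moreover have "con (W - {t, y}) z x" using \<open>x \<in> Z\<close> by (simp add: Z_def component_def)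
      ultimately have "v0 \<in> Z" using con_trans by (auto simp: Z_def component_def)
      then show False using no_nb v0(2,3) by blast
    qed
    then show "x \<in> W1" using x rho(5) r by (auto simp: W1_def)
  qed
  \<comment> \<open>\<open>W1\<close> can be left to \<open>Z\<close> only from \<open>y\<close>,
    and to \<open>t\<close> only from a neighbour of \<open>t\<close>, hence from a vertex of
    \<open>rho\<close>.\<close>
  have W1_nbs: "u = y \<or> u \<in> set (y # r2)"
    if uu: "u \<in> W1" "E u u'" "u' \<in> W - W1" for u u'
  proof -
    consider "u' \<in> Z" | "u' = t" using uu(3) by (auto simp: W1_def)
    then show ?thesis
    proof cases
      case 1
      then show ?thesis using exit[OF 1 E_sym[OF uu(2)]] uu(1) by (auto simp: W1_def)
    next
      case 2
      then have "u \<in> set rho"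
        using in_rho[of u] uu(1) E_sym[OF uu(2)] zZ by (auto simp: W1_def)
      then show ?thesis using r r1Z uu(1) by (auto simp: W1_def)
    qed
  qed
  have chn1: "anchored_to W1 S y"
    unfolding anchored_to_def
  proof (intro conjI allI ballI)
    have toy: "con W1 w y" if w: "w \<in> W1" for w
    proof -
      have "con W w y" using W w y(1) by (auto simp: connected_def W1_def)
      from first_exit[OF this w] show ?thesis
      proof
        assume "\<exists>u u'. con W1 w u \<and> E u u' \<and> u' \<in> W - W1"
        then obtain u u' where u: "con W1 w u" "E u u'" "u' \<in> W - W1" by blast
        then have "u \<in> set (y # r2)" using W1_nbs[of u u'] con_in[OF u(1)] by auto
        then have "con (set (y # r2)) u y" using path_con[OF s2] by simp
        then have "con W1 u y" using r2W1 by (rule con_mono)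
        then show ?thesis using u(1) con_trans by blast
      qed
    qed
    show "connected W1"
      unfolding connected_def using toy con_sym con_trans by meson
    show "y \<in> W1" by (rule yW1)
  next
    fix c w assume w: "w \<in> W1 - {c}"
    then obtain v where v: "con (W - {c}) w v" "v \<in> nb S \<or> v = z"
      using reach[of w c] by (auto simp: W1_def)
    from first_exit[OF v(1) w] show "\<exists>v. con (W1 - {c}) w v \<and> (v \<in> nb S \<or> v = y)"
    proof
      assume "con (W1 - {c}) w v"
      moreover from con_in[OF this] have "v \<noteq> z" using zZ by (auto simp: W1_def)
      ultimately show ?thesis using v(2) by blast
    next
      assume "\<exists>u u'. con (W1 - {c}) w u \<and> E u u' \<and> u' \<in> W - {c} - (W1 - {c})"
      then obtain u u' where u: "con (W1 - {c}) w u" "E u u'" "u' \<in> W - W1" by blast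
      have "u \<in> W1" "u \<noteq> c" using con_in[OF u(1)] by auto
      then have "u \<in> set (y # r2)" using W1_nbs[of u u'] u by auto
      \<comment> \<open>Whatever \<open>c\<close> is deleted, one direction along \<open>rho\<close>
        remains open: towards \<open>y\<close>, or towards \<open>v0\<close>, a neighbour of
        \<open>S\<close>.\<close>
      from path_avoid[OF s2 d2 this \<open>u \<noteq> c\<close>] obtain x
        where x: "con (set (y # r2) - {c}) u x" "x = y \<or> x = v0"
        using last2 by auto
      from con_mono[OF x(1), of "W1 - {c}"] r2W1 have "con (W1 - {c}) u x" by blast
      then have "con (W1 - {c}) w x" using u(1) con_trans by blast
      then show ?thesis using x(2) v0(2) by blast
    qed
  qed
  have chn2: "anchored_to Z {y} z"
    unfolding anchored_to_def
  proof (intro conjI allI ballI)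
    show "connected Z" using connected_component by (simp add: Z_def)
    show "z \<in> Z" by (rule zZ)
    fix c w assume w: "w \<in> Z - {c}"
    then obtain v where v: "con (W - {c}) w v" "v \<in> nb S \<or> v = z" using reach[of w c] ZW by blast
    from first_exit[OF v(1) w] show "\<exists>v. con (Z - {c}) w v \<and> (v \<in> nb {y} \<or> v = z)"
    proof
      assume "con (Z - {c}) w v"
      moreover from con_in[OF this] have "v \<in> Z" by blast
      ultimately show ?thesis using v(2) no_nb by blast
    next
      assume "\<exists>u u'. con (Z - {c}) w u \<and> E u u' \<and> u' \<in> W - {c} - (Z - {c})"
      then obtain u u' where u: "con (Z - {c}) w u" "E u u'" "u' \<in> W" "u' \<notin> Z" by blast
      have uZ: "u \<in> Z" "u \<noteq> c" using con_in[OF u(1)] by auto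
      then have "u' = t \<or> u' = y" using exit[of u u'] u by blast
      then show ?thesis
      proof
        assume "u' = y"
        then have "u \<in> nb {y}" using E_sym[OF u(2)] by simp
        then show ?thesis using u(1) by blast
      next
        assume "u' = t"
        show ?thesis
        proof (cases "u = z")
          case True
          then show ?thesis using u(1) by blast
        next
          case False
          then have "u \<in> set rho"
            using in_rho[of u] uZ ZW E_sym[OF u(2)] \<open>u' = t\<close> by blast
          then have "u \<in> set r1" using r r2W1 uZ(1) by (auto simp: W1_def)
          from path_avoid[OF s1(1) d1 this uZ(2)] obtain x
            where x: "con (set r1 - {c}) u x" "x = z \<or> x = last r1"
            using hd1 by auto
          from con_mono[OF x(1), of "Z - {c}"] r1Z have "con (Z - {c}) u x" by blast
          then have "con (Z - {c}) w x" using u(1) con_trans by blast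
          moreover have "x \<in> nb {y} \<or> x = z" using x(2) E_sym[OF s1(2)] by auto
          ultimately show ?thesis by blast
        qed
      qed
    qed
  qed
  have card: "card W1 < card W" "card Z < card W"
    using zZ ZW zW assms(2,3) by (intro psubset_card_mono; auto simp: W1_def)+
  have "y \<in> nb S" if "W1 = {y}"
  proof -
    have "v0 \<in> W1" using r2W1 last2 last_in_set[of "y # r2"] by auto
    then show ?thesis using that v0(2) by blast
  qed
  then obtain L1 where L1: "route W1 S y L1"
    using solved_route[OF assms(1) card(1) _ chn1] assms(2) by (auto simp: W1_def)
  have "z \<in> nb {y}" if "Z = {z}"
  proof -
    have "last r1 = z" using r1Z last_in_set[OF \<open>r1 \<noteq> []\<close>] that by blast
    then show ?thesis using E_sym[OF s1(2)] by simp
  qed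
  then obtain L2 where L2: "route Z {y} z L2"
    using solved_route[OF assms(1) card(2) finite_subset[OF ZW(1) assms(2)] chn2] by blast
  have "adj2 t (hd L2)" using L2 y(4) by (auto simp: route_def adj2_def)
  have "route W S z (L1 @ t # L2)"
    unfolding route_def
  proof (intro conjI)
    have "successively (link S) L2"
      using L2 unfolding route_def by (auto elim!: successively_mono intro: adj2_link)
    then have "successively (link S) (t # L2)"
      using adj2_link[OF \<open>adj2 t (hd L2)\<close>, of S] by (cases L2) auto
    then show "successively (link S) (L1 @ t # L2)"
      using L1 E_link[OF E_sym[OF y(4)]] by (simp add: route_def successively_append_iff)
    show "set (L1 @ t # L2) = W"
      using L1 L2 ZW assms(3) by (auto simp: route_def W1_def)
  qed (use L1 L2 ZW in \<open>auto simp: route_def W1_def\<close>)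
  moreover have "edge_at t (L1 @ t # L2)"
    using sublist_join[of L1 "t # L2"] L1 y(4) unfolding edge_at_def route_def by auto
  ultimately show ?thesis by blast
qed

text \<open>Only \<open>qs\<close> is removed; the first vertex \<open>v0\<close> of the path stays
  in its component, where it offers a free choice of label. Since \<open>y\<close> stays with
  \<open>t\<close>, the component of \<open>t\<close> has an edge at \<open>t\<close>. Its list
  comes from the induction hypothesis, which preserves such an edge, unlike a two-sided
  cover.\<close>

lemma main_detour:
  assumes solved: "solved (card W)" and "finite W" "t \<in> W" "t \<noteq> z" "anchored_to W S z"
    and y: "y \<in> W" "y \<noteq> z" "y \<noteq> t" "E t y"
    and v0: "con (W - {t, y}) v0 z" "v0 \<in> nb S" "v0 \<noteq> z"
  shows "\<exists>L. route W S z L \<and> edge_at t L"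
proof -
  have zW: "z \<in> W"
    and reach: "\<And>c w. w \<in> W - {c} \<Longrightarrow> \<exists>v. con (W - {c}) w v \<and> (v \<in> nb S \<or> v = z)"
    using assms(5) by (auto simp: anchored_to_def)
  obtain ps where ps: "ps \<noteq> []" "hd ps = v0" "last ps = z" "distinct ps" "set ps \<subseteq> W - {t, y}"
    "successively E ps"
    using con_path[OF v0(1)] by blast
  then obtain qs where qs0: "ps = v0 # qs" by (cases ps) auto
  then have "qs \<noteq> []" using ps(3) v0(3) by auto
  then have qs: "last qs = z" "distinct qs" "v0 \<notin> set qs" "set qs \<subseteq> W - {t, y}" "successively E qs"
    "E v0 (hd qs)" "v0 \<in> W - {t, y}"
    using ps qs0 by (auto simp: successively_Cons)
  define m where "m = length qs"
  define q where "q = (\<lambda>k. qs ! (k - 1))"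
  \<comment> \<open>Only \<open>z\<close> carries the label \<open>m + 1\<close>, so a trail ending
    there ends exactly at \<open>z\<close>.\<close>
  define N where "N l = (if l = 0 then nb S else if l \<le> m then insert (q l) (nb {q l}) else {z})" for l
  define U where "U = W - set qs"
  define S' where "S' = S \<union> set qs"
  define \<K> where "\<K> = component U ` U"
  let ?R = "link S"
  have "1 \<le> m" using \<open>qs \<noteq> []\<close> by (cases qs) (auto simp: m_def)
  have q_map: "map q [1..<m + 1] = qs"
    using map_nth_shift[of qs] by (simp only: q_def m_def)
  have q_in: "q k \<in> set qs" if "k \<in> {1..m}" for k
    using that by (auto simp: q_def m_def)
  have q_E: "E (q k) (q (k + 1))" if "1 \<le> k" "k < m" for k
    using successively_nth[OF qs(5), of "k - 1"] that by (simp add: q_def m_def)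
  have q_surj: "\<exists>k\<in>{1..m}. x = q k" if "x \<in> set qs" for x
  proof -
    have "x \<in> q ` set [1..<m + 1]" using that q_map by (metis set_map)
    then show ?thesis by auto
  qed
  have q_first: "E v0 (q 1)" and q_last: "q m = z"
    using qs(1,6) \<open>qs \<noteq> []\<close> by (auto simp: q_def m_def hd_conv_nth last_conv_nth)
  have z_in: "z \<in> set qs" using qs(1) \<open>qs \<noteq> []\<close> last_in_set by metis
  have cl: "cliques N ?R"
    unfolding cliques_def
  proof (intro allI ballI impI)
    fix l x y assume *: "x \<in> N l" "y \<in> N l" "x \<noteq> y"
    consider "l = 0" | "1 \<le> l" "l \<le> m" | "m < l" by linarith
    then show "?R x y"
    proof cases
      case 2
      then have "x = q l \<or> E (q l) x" "y = q l \<or> E (q l) y"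
        using * by (auto simp: N_def)
      then have "adj2 x y" using * E_sym[of "q l" x] by (auto simp: adj2_def)
      then show ?thesis by (simp add: link_def)
    qed (use * in \<open>auto simp: N_def link_def\<close>)
  qed
  \<comment> \<open>The label \<open>0\<close> is excluded: \<open>q 1\<close> is adjacent to
    \<open>v0\<close> but need not be a neighbour of \<open>S\<close>.\<close>
  have q_N: "q k \<in> N l" if kl: "k \<in> {1..m}" "l \<in> {k - 1, k, k + 1}" "l \<noteq> 0" for k l
  proof -
    consider "l = k - 1" "1 < k" | "l = k" | "l = k + 1" "k = m"
      | "l = k + 1" "k < m" using kl by fastforce
    then show ?thesis
    proof cases
      case 1
      then show ?thesis using q_E[of l] kl by (auto simp: N_def)
    next
      case 4
      then show ?thesis using E_sym[OF q_E[of k]] kl by (auto simp: N_def)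
    qed (use kl q_last in \<open>auto simp: N_def\<close>)
  qed
  have finU: "finite U" using assms(2) by (simp add: U_def)
  have tyU: "t \<in> U" "y \<in> U" "v0 \<in> U" using qs(3,4,7) assms(3) y by (auto simp: U_def)
  have labels: "\<exists>l\<in>{..m}. x \<in> N l" if x: "x \<in> nb S'" for x
  proof -
    from x consider "x \<in> nb S" | k where "k \<in> {1..m}" "E (q k) x"
      unfolding S'_def nb_iff using q_surj by blast
    then show ?thesis
    proof cases
      case 1
      then show ?thesis by (intro bexI[of _ 0]) (auto simp: N_def)
    next
      case 2
      then show ?thesis by (intro bexI[of _ k]) (auto simp: N_def)
    qed
  qed
  have lists: "\<exists>L. L \<noteq> [] \<and> distinct L \<and> set L = V \<and> hd L \<in> nb S' \<and> last L \<in> nb S' \<and>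
      successively (\<lambda>x y. ?R x y \<or> x \<in> nb S' \<and> y \<in> nb S') L \<and> (t \<in> V \<longrightarrow> edge_at t L) \<and>
      (v0 \<in> V \<longrightarrow> last L = v0)" if V: "V \<in> \<K>" for V
  proof -
    obtain x where x: "x \<in> U" "V = component U x" using V by (auto simp: \<K>_def)
    have VU: "V \<subseteq> U" "x \<in> V" using component_subset component_self x by auto
    have finV: "finite V" using VU(1) finU finite_subset by blast
    have cardV: "card V < card W"
      using VU(1) z_in zW assms(2) by (intro psubset_card_mono) (auto simp: U_def)
    have blkV: "anchored V S'"
      using component_anchored[of W S "set qs" V x] reach x z_in unfolding S'_def U_def by blast
    have y_in: "y \<in> V" if "t \<in> V"
      using component_exit[of t U x y] that x y(4) tyU by simp
    \<comment> \<open>The end for the list of \<open>V\<close>. Unless \<open>v0\<close> prescribes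
      it, anchoring yields one: deleting \<open>t\<close> and starting at \<open>y\<close> gives an
      end other than \<open>t\<close>. If \<open>t\<close> is not in \<open>V\<close>, deleting
      \<open>z\<close>, a path vertex, removes nothing from \<open>V\<close>.\<close>
    obtain z' where z': "z' \<in> V" "z' \<in> nb S'" "v0 \<in> V \<longrightarrow> z' = v0" "t \<in> V \<longrightarrow> z' \<noteq> t"
    proof (cases "v0 \<in> V")
      case True
      then show ?thesis using that[of v0] v0(2) qs(7) by (auto simp: S'_def)
    next
      case False
      define c w where "c = (if t \<in> V then t else z)" and "w = (if t \<in> V then y else x)"
      have "w \<in> V - {c}"
        using y_in VU z_in y(3) by (auto simp: c_def w_def U_def)
      then obtain v where "v \<in> nb S'" "con (V - {c}) w v" using blkV unfolding anchored_def by blast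
      moreover from this have "v \<in> V" "t \<in> V \<longrightarrow> v \<noteq> t"
        using con_in[of "V - {c}" w v] by (auto simp: c_def)
      ultimately show ?thesis using that[of v] False by blast
    qed
    have chnV: "anchored_to V S' z'"
      using blkV z'(1) connected_component[of U x] x(2) unfolding anchored_to_def anchored_def by blast
    show ?thesis
    proof (cases "V = {z'}")
      case True
      then have "t \<notin> V" using z'(4) by auto
      then show ?thesis using True z' by (intro exI[of _ "[z']"]) auto
    next
      case False
      then obtain t' where t': "t' \<in> V" "t' \<noteq> z'" "t \<in> V \<longrightarrow> t' = t"
        using z'(1,4) by (cases "t \<in> V") blast+
      obtain L where L: "route V S' z' L" "edge_at t' L"
        using solved cardV finV t'(1,2) chnV unfolding solved_def by blast
      have "successively (\<lambda>x y. ?R x y \<or> x \<in> nb S' \<and> y \<in> nb S') L"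
        using L(1) unfolding route_def link_def by (auto elim!: successively_mono)
      then show ?thesis using L z' t'(3) by (intro exI[of _ L]) (auto simp: route_def)
    qed
  qed
  have edge_piece: "\<exists>p\<in>P. edge_at t (fst (snd p))"
    if "edge_at t L" "\<And>u v. sublist [u, v] L \<Longrightarrow> ?R u v \<Longrightarrow> \<exists>p\<in>P. sublist [u, v] (fst (snd p))" for L and P :: "'a piece set"
  proof -
    obtain b where b: "E t b" "sublist [t, b] L \<or> sublist [b, t] L"
      using \<open>edge_at t L\<close> by (auto simp: edge_at_def)
    then show ?thesis
      using that(2)[OF _ E_link[OF b(1)]] that(2)[OF _ E_link[OF E_sym[OF b(1)]]]
      unfolding edge_at_def by blast
  qed
  define V0 where "V0 = component U v0"
  have V0: "V0 \<in> \<K>" "v0 \<in> V0" using tyU(3) component_self by (auto simp: V0_def \<K>_def)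
  have pieces: "\<exists>M. content M = mset_set V \<and> (\<forall>p\<in>#M. piece_ok N ?R p \<and> fst p \<le> m \<and> snd (snd p) \<le> m) \<and>
      (t \<in> V \<longrightarrow> (\<exists>p\<in>#M. edge_at t (fst (snd p))))" if V: "V \<in> \<K> - {V0}" for V
  proof -
    obtain L where L: "L \<noteq> []" "distinct L" "set L = V" "hd L \<in> nb S'" "last L \<in> nb S'"
      "successively (\<lambda>x y. ?R x y \<or> x \<in> nb S' \<and> y \<in> nb S') L" "t \<in> V \<longrightarrow> edge_at t L"
      using lists V by blast
    obtain i j where ij: "i \<in> {..m}" "hd L \<in> N i" "j \<in> {..m}" "last L \<in> N j"
      using labels[OF L(4)] labels[OF L(5)] by blast
    show ?thesis
    proof (rule break_list_closed[OF L(1,6) ij(2) labels ij(3,4)])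
      fix rs assume rs: "glue rs = L" and rs':
        "\<And>p. p \<in> set rs \<Longrightarrow> piece_ok N ?R p \<and> fst p \<in> insert i {..m} \<and> snd (snd p) \<in> {..m}"
        "\<And>u v. sublist [u, v] L \<Longrightarrow> ?R u v \<Longrightarrow> \<exists>p\<in>set rs. sublist [u, v] (fst (snd p))"
      have "content (mset rs) = mset_set V"
        using rs L(2,3) mset_set_set[of L] by (simp add: content_mset)
      moreover have "t \<in> V \<longrightarrow> (\<exists>p\<in>#mset rs. edge_at t (fst (snd p)))"
        using edge_piece[of L "set rs"] rs'(2) L(7) by auto
      moreover have "\<forall>p\<in>#mset rs. piece_ok N ?R p \<and> fst p \<le> m \<and> snd (snd p) \<le> m"
        using rs'(1) ij(1) by auto
      ultimately show ?thesis by blast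
    qed
  qed
  obtain M2 where M2: "content M2 = mset_set (\<Union>(\<K> - {V0}))"
    "\<forall>p\<in>#M2. piece_ok N ?R p \<and> fst p \<le> m \<and> snd (snd p) \<le> m"
    "(\<exists>V\<in>\<K> - {V0}. t \<in> V) \<longrightarrow> (\<exists>p\<in>#M2. edge_at t (fst (snd p)))"
  proof -
    have fin: "finite V" if "V \<in> \<K> - {V0}" for V
      using that finite_subset[OF component_subset finU] by (auto simp: \<K>_def)
    have "finite (\<K> - {V0})" using finU by (simp add: \<K>_def)
    moreover have "pairwise disjnt (\<K> - {V0})"
      using components_disjoint[of U] by (auto simp: \<K>_def intro: pairwise_subset)
    ultimately show ?thesis using collect_pieces[OF _ _ fin pieces] that by blast
  qed
  obtain L0 where L0: "L0 \<noteq> []" "distinct L0" "set L0 = V0" "hd L0 \<in> nb S'" "last L0 = v0"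
    "successively (\<lambda>x y. ?R x y \<or> x \<in> nb S' \<and> y \<in> nb S') L0" "t \<in> V0 \<longrightarrow> edge_at t L0"
    using lists[OF V0(1)] V0(2) by blast
  obtain i0 where i0: "i0 \<in> {..m}" "hd L0 \<in> N i0" using labels[OF L0(4)] by blast
  \<comment> \<open>The last fragment \<open>xs\<close> ends at \<open>v0\<close>; its right label
    is left open until the other pieces are known.\<close>
  obtain rs i xs where rs: "L0 = glue rs @ xs" "xs \<noteq> []" "hd xs \<in> N i" "successively ?R xs"
    "\<forall>p\<in>set rs. piece_ok N ?R p \<and> fst p \<in> insert i0 {..m} \<and> snd (snd p) \<in> {..m}" "i \<in> insert i0 {..m}"
    "\<And>u v. sublist [u, v] L0 \<Longrightarrow> ?R u v \<Longrightarrow> sublist [u, v] xs \<or> (\<exists>p\<in>set rs. sublist [u, v] (fst (snd p)))"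
    using break_list[OF L0(1,6) i0(2) labels] by blast
  define M1 where "M1 = mset rs + M2"
  \<comment> \<open>The vertex \<open>v0\<close> carries both labels 0 and 1, which settles the parity of the label 0.\<close>
  define w where "w = (if even (deg 0 (add_mset (i, xs, 1) M1)) then 0 else 1 :: nat)"
  define M where "M = add_mset (i, xs, w) M1"
  have w: "w \<le> 1" by (simp add: w_def)
  have odd0: "odd (deg 0 M)"
  proof (cases "even (deg 0 (add_mset (i, xs, 1) M1))")
    case True
    then have "w = 0" by (simp only: w_def if_True)
    then show ?thesis using True by (simp add: M_def)
  next
    case False
    then have "w = 1" by (simp only: w_def if_False)
    then show ?thesis using False by (simp add: M_def)
  qed
  have "last xs = v0" using L0(5) rs(1,2) by simp
  then have "last xs \<in> N w"
    using w v0(2) E_sym[OF q_first] \<open>1 \<le> m\<close> by (cases "w = 0") (auto simp: N_def le_Suc_eq)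
  then have "piece_ok N ?R (i, xs, w)" using rs(2-4) by (simp add: piece_ok_def)
  then have Mok: "piece_ok N ?R p \<and> fst p \<le> m \<and> snd (snd p) \<le> m" if "p \<in># M" for p
    using that M2(2) rs(5,6) i0(1) w \<open>1 \<le> m\<close> by (auto simp: M_def M1_def)
  have bm: "labels_le m M" using Mok by (auto simp: labels_le_def)
  then have bM: "labels_le (m + 1) M" by (auto simp: labels_le_def)
  have "deg (m + 1) M = 0" using labels_le_deg[OF bm] by simp
  then have even_top: "even (deg (m + 1) M)" by simp
  have contM: "content M = mset_set U"
  proof -
    have un: "V0 \<union> \<Union>(\<K> - {V0}) = U"
      using Union_components[of U] V0(1) by (auto simp: \<K>_def)
    have dj: "V0 \<inter> \<Union>(\<K> - {V0}) = {}"
    proof -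
      have "V0 \<inter> V = {}" if "V \<in> \<K> - {V0}" for V
        using pairwiseD[OF components_disjoint[of U], of V0 V] that V0(1) by (auto simp: disjnt_def \<K>_def)
      then show ?thesis by blast
    qed
    have "content M = mset L0 + mset_set (\<Union>(\<K> - {V0}))"
      using rs(1) M2(1) by (simp add: M_def M1_def content_mset)
    also have "mset L0 = mset_set V0" using L0(2,3) mset_set_set[of L0] by simp
    also have "mset_set V0 + mset_set (\<Union>(\<K> - {V0})) = mset_set (V0 \<union> \<Union>(\<K> - {V0}))"
      using dj un finU by (subst mset_set_Union) (metis finite_Un)+
    finally show ?thesis using un by simp
  qed
  have edgeM: "\<exists>p\<in>#M. edge_at t (fst (snd p))"
  proof (cases "t \<in> V0")
    case True
    have "\<exists>p\<in>insert (i, xs, w) (set rs). edge_at t (fst (snd p))"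
      by (rule edge_piece[of L0]) (use True L0(7) rs(7) in auto)
    then show ?thesis by (auto simp: M_def M1_def)
  next
    case False
    have "component U t \<in> \<K> - {V0}" "t \<in> component U t"
      using tyU(1) component_self[of t U] False by (auto simp: \<K>_def)
    then show ?thesis using M2(3) by (auto simp: M_def M1_def)
  qed
  obtain Q where Q: "spine q 1 (m + 1) Q" "\<And>l. l \<in> {1..m} \<Longrightarrow> even (deg l (M + Q))"
    "linked (M + Q)" "odd (deg 0 (M + Q))" "odd (deg (m + 1) (M + Q))" "deg 0 Q = 0"
    using spine_odd_even[OF bM \<open>1 \<le> m\<close> odd0 even_top, of q] by blast
  have ok: "piece_ok N ?R p" if p: "p \<in># M + Q" for p
  proof -
    have "p \<in># M \<or> p \<in># Q" using p by simp
    then show ?thesis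
    proof
      assume pQ: "p \<in># Q"
      from spine_mem[OF Q(1) this] obtain k x y where k: "1 \<le> k" "k < m + 1" "p = (x, [q k], y)"
        "x \<in> {k - 1, k, k + 1}" "y \<in> {k - 1, k, k + 1}" by blast
      have "x \<noteq> 0" "y \<noteq> 0" using Q(6) pQ k(3) by (auto simp: deg_eq_0_iff)
      then show ?thesis using q_N[of k x] q_N[of k y] k by (simp add: piece_ok_def)
    qed (use Mok in blast)
  qed
  have contMQ: "content (M + Q) = mset_set W"
  proof -
    have "content (M + Q) = mset_set U + mset_set (set qs)"
      using contM spine_cont[OF Q(1)] mset_set_set[OF qs(2)] q_map by (simp del: upt_Suc mset_map)
    also have "\<dots> = mset_set (U \<union> set qs)"
      using finU by (subst mset_set_Union) (auto simp: U_def)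
    also have "U \<union> set qs = W" using qs(4) by (auto simp: U_def)
    finally show ?thesis .
  qed
  have bMQ: "labels_le (m + 1) (M + Q)" using bM spine_bounded[OF Q(1)] by simp
  have even_mid: "even (deg l (M + Q))" if "l \<noteq> 0" "l \<noteq> m + 1" for l
  proof (cases "l \<le> m")
    case True
    then show ?thesis using Q(2)[of l] that by simp
  next
    case False
    then show ?thesis using labels_le_deg[OF bMQ, of l] that by simp
  qed
  have "0 \<noteq> m + 1" by simp
  from assemble_open[OF ok symp_link cl contMQ assms(2) even_mid Q(4,5,3) this]
  obtain L where L: "L \<noteq> []" "distinct L" "set L = W" "hd L \<in> N 0" "last L \<in> N (m + 1)"
    "successively ?R L"
    "\<And>p. p \<in># M + Q \<Longrightarrow> sublist (fst (snd p)) L \<or> sublist (rev (fst (snd p))) L" by blast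
  have "route W S z L" using L(1-6) by (simp add: route_def N_def)
  moreover have "edge_at t L"
    using edgeM L(7) edge_at_mono by (metis union_iff)
  ultimately show ?thesis by blast
qed

text \<open>The split asks what blocks a path from a neighbour of \<open>S\<close> to
  \<open>z\<close> that avoids \<open>t\<close> and some neighbour of \<open>t\<close>: the vertex
  \<open>t\<close> alone, the absence of a neighbour other than \<open>z\<close>, or each such
  neighbour together with \<open>t\<close>.\<close>

theorem route_with_edge:
  assumes "finite W" "t \<in> W" "t \<noteq> z" "anchored_to W S z"
  shows "\<exists>L. route W S z L \<and> edge_at t L"
  using assms
proof (induction "card W" arbitrary: W S z t rule: less_induct)
  case less
  have solved: "solved (card W)"
    using less.hyps unfolding solved_def by blast
  note prems = less.prems
  show ?case
  proof (cases "component (W - {t}) z \<inter> nb S \<subseteq> {z}")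
    case True
    then show ?thesis by (rule main_separated[OF solved prems])
  next
    case False
    then obtain v0 where v0: "con (W - {t}) z v0" "v0 \<in> nb S" "v0 \<noteq> z"
      by (auto simp: component_def)
    show ?thesis
    proof (cases "nb {t} \<inter> (W - {z}) = {}")
      case True
      then show ?thesis by (rule main_pendant[OF prems])
    next
      case False
      show ?thesis
      proof (cases "\<exists>y v. y \<in> W \<and> y \<noteq> z \<and> y \<noteq> t \<and> E t y \<and> v \<in> nb S \<and> v \<noteq> z \<and> con (W - {t, y}) v z")
        case True
        then show ?thesis using main_detour[OF solved prems] by blast
      next
        case no_detour: False
        obtain y where "y \<in> nb {t}" "y \<in> W" "y \<noteq> z" using False by blast
        moreover from this have "y \<noteq> t" "E t y" using E_irrefl by auto
        ultimately show ?thesis using main_cut_pairs[OF solved prems v0, of y] no_detour by blast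
      qed
    qed
  qed
qed

end

section \<open>Squares of 2-connected graphs\<close>

lemma graph_dist_le_2:
  assumes "pair_graph G" and "(u, v) \<in> parcs G \<or> (\<exists>c. (u, c) \<in> parcs G \<and> (c, v) \<in> parcs G)"
  shows "graph_dist G u v \<le> 2"
proof -
  interpret pair_graph G by fact
  have "\<exists>p. awalk u p v \<and> length p \<le> 2"
    using assms(2)
  proof
    assume uv: "(u, v) \<in> parcs G"
    then have "awalk u [(u, v)] v"
      using in_arcsD1 by (simp add: awalk_def)
    then show ?thesis by (intro exI[of _ "[(u, v)]"]) simp
  next
    assume "\<exists>c. (u, c) \<in> parcs G \<and> (c, v) \<in> parcs G"
    then obtain c where c: "(u, c) \<in> parcs G" "(c, v) \<in> parcs G" by blast
    then have "awalk u [(u, c), (c, v)] v"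
      using in_arcsD1 by (simp add: awalk_def)
    then show ?thesis by (intro exI[of _ "[(u, c), (c, v)]"]) simp
  qed
  then obtain p where p: "awalk u p v" "length p \<le> 2" by blast
  have "awalk_cost (\<lambda>_. 1) p = real (length p)"
    by (induction p) auto
  then have "\<mu> (\<lambda>_. 1) u v \<le> real (length p)"
    using min_cost_le_walk_cost[OF p(1), of "\<lambda>_. 1"] by simp
  also have "\<dots> \<le> ereal 2" using p(2) by simp
  finally show ?thesis by (simp add: graph_dist_def)
qed

lemma hamiltonian_path_of_list:
  assumes "P \<noteq> []" "distinct P" "set P = pverts G" "successively (\<lambda>x y. (x, y) \<in> parcs G) P"
  shows "hamiltonian_path G (hd P) (zip P (tl P)) (last P)"
proof -
  have "pawalk_verts (hd P) (zip P (tl P)) = P \<and> pcas (hd P) (zip P (tl P)) (last P) \<and>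
      set (zip P (tl P)) \<subseteq> parcs G"
    using assms(1,4)
  proof (induction P rule: list_nonempty_induct)
    case (cons x xs)
    then show ?case by (cases xs) auto
  qed simp
  then show ?thesis
    using assms(1-3) hd_in_set[OF assms(1)]
    by (simp add: hamiltonian_path_def pre_digraph.apath_def pre_digraph.awalk_def
        cas_with_proj_eq awalk_verts_with_proj_eq)
qed

lemma path_edges_of_sublist:
  assumes "sublist [a, b] P \<or> sublist [b, a] P"
  shows "{a, b} \<in> path_edges (zip P (tl P))"
proof -
  have "(c, d) \<in> set (zip P (tl P))" if "sublist [c, d] P" for c d
  proof -
    obtain us vs where "P = us @ c # d # vs" using \<open>sublist [c, d] P\<close> by (auto simp: sublist_def)
    then show ?thesis by (induction us arbitrary: P) (case_tac us; auto)+
  qed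
  then show ?thesis
    using assms unfolding path_edges_def by (force simp: insert_commute)
qed

lemma sgraph_parcs:
  assumes "pair_graph G"
  shows "sgraph (\<lambda>x y. (x, y) \<in> parcs G)"
proof
  interpret pair_graph G by fact
  show "(y, x) \<in> parcs G" if "(x, y) \<in> parcs G" for x y
    by (rule arcs_symmetric[OF that])
  show "(x, x) \<notin> parcs G" for x
    using no_loops[of "(x, x)"] by auto
qed

text \<open>Connectedness is defined through the symmetric closure, which adds no arcs here because
  the graph is symmetric.\<close>

lemma con_induced:
  assumes "pair_graph G" "Digraph_Component.connected (with_proj G \<restriction> U)" "u \<in> U" "v \<in> U"
  shows "sgraph.con (\<lambda>x y. (x, y) \<in> parcs G) U u v"
proof -
  interpret pair_graph G by fact
  interpret sgraph "\<lambda>x y. (x, y) \<in> parcs G" by (rule sgraph_parcs) fact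
  have "u \<rightarrow>\<^sup>*\<^bsub>mk_symmetric (with_proj G \<restriction> U)\<^esub> v"
    using assms(2-4) by (auto simp: Digraph_Component.connected_def strongly_connected_def mk_symmetric_def)
  then have "(u, v) \<in> rtrancl_on U (parcs (mk_symmetric (with_proj G \<restriction> U)))"
    by (simp add: reachable_def mk_symmetric_def)
  then show ?thesis
  proof (induction rule: rtrancl_on_induct)
    case base
    then show ?case by (rule con_refl)
  next
    case (step v w)
    then have "(v, w) \<in> parcs G" "w \<in> U"
      using E_sym by (auto simp: mk_symmetric_def)
    then show ?case using step.IH con_step by blast
  qed
qed

theorem theorem3:
  fixes G :: "'a pair_pre_digraph"
  assumes "pair_graph G" and "k_connected 2 G"
  shows "strong_F3 G"
proof -
  interpret pair_graph G by fact
  interpret sgraph "\<lambda>x y. (x, y) \<in> parcs G" by (rule sgraph_parcs) fact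
  have conn: "con (pverts G - X) u v"
    if "X \<subseteq> pverts G" "card X < 2" "u \<in> pverts G - X" "v \<in> pverts G - X" for X u v
    using con_induced[OF assms(1) _ that(3,4)] assms(2) that(1,2) by (simp add: k_connected_def)
  have main: "\<exists>P b c. P \<noteq> [] \<and> distinct P \<and> set P = pverts G \<and> successively adj2 P \<and> hd P = s \<and> last P = z \<and>
      (t, b) \<in> parcs G \<and> (s, c) \<in> parcs G \<and> {t, b} \<noteq> {s, c} \<and>
      (sublist [t, b] P \<or> sublist [b, t] P) \<and> sublist [s, c] P"
    if V: "s \<in> pverts G" "z \<in> pverts G" "t \<in> pverts G" and d: "s \<noteq> z" "s \<noteq> t" "z \<noteq> t" for s z t
  proof -
    \<comment> \<open>The vertex \<open>s\<close> plays the role of the contracted set: the list of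
      \<open>W\<close> starts at a neighbour of \<open>s\<close>, and this gives the second required
      edge.\<close>
    define W where "W = pverts G - {s}"
    have toz: "con W u z" if "u \<in> W" for u
      using conn[of "{s}" u z] that V d by (simp add: W_def)
    have "anchored_to W {s} z"
      unfolding anchored_to_def
    proof (intro conjI allI ballI)
      show "connected W"
        unfolding connected_def using conn[of "{s}"] V(1) by (simp add: W_def)
      show "z \<in> W" using V d by (simp add: W_def)
      fix c w assume w: "w \<in> W - {c}"
      show "\<exists>v. con (W - {c}) w v \<and> (v \<in> nb {s} \<or> v = z)"
      proof (cases "c = s")
        case True
        then have "W - {c} = W" by (simp add: W_def)
        then show ?thesis using toz w by auto
      next
        case False
        have "con (pverts G - {c}) w s"
        proof (cases "c \<in> pverts G")
          case True
          then show ?thesis using conn[of "{c}" w s] w False V(1) by (auto simp: W_def)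
        next
          \<comment> \<open>Anchoring quantifies over all \<open>c\<close>; one outside the graph
            deletes nothing.\<close>
          case False
          then have "pverts G - {c} = pverts G - {}" by simp
          then show ?thesis using conn[of "{}" w s] w V(1) by (auto simp: W_def)
        qed
        moreover have "\<not> con (W - {c}) w s" using con_in[of "W - {c}" w s] by (auto simp: W_def)
        ultimately obtain u u' where u: "con (W - {c}) w u" "(u, u') \<in> parcs G"
          "u' \<in> pverts G - {c} - (W - {c})"
          using first_exit[OF _ w] by blast
        then have "u' = s" by (auto simp: W_def)
        then show ?thesis using u(1) E_sym[OF u(2)] by auto
      qed
    qed
    moreover have "finite W" "t \<in> W" "t \<noteq> z" using V d by (auto simp: W_def)
    ultimately obtain L where L: "route W {s} z L" "edge_at t L"
      using route_with_edge by blast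
    obtain b where b: "(t, b) \<in> parcs G" "sublist [t, b] L \<or> sublist [b, t] L"
      using L(2) by (auto simp: edge_at_def)
    have "b \<in> W" "s \<notin> W"
      using set_mono_sublist[of "[t, b]" L] set_mono_sublist[of "[b, t]" L] b(2) L(1)
      by (auto simp: route_def W_def)
    have L': "L \<noteq> []" "distinct L" "set L = W" "(s, hd L) \<in> parcs G" "last L = z" "successively adj2 L"
      using L(1) unfolding route_def by (auto elim!: successively_mono)
    have "adj2 s (hd L)" using L'(4) by (simp add: adj2_def)
    define P where "P = s # L"
    have "P \<noteq> []" "distinct P" "hd P = s" "last P = z"
      using L' \<open>s \<notin> W\<close> by (simp_all add: P_def)
    moreover have "set P = pverts G"
      using L'(3) V(1) by (auto simp: P_def W_def)
    moreover have "successively adj2 P" using L'(1,6) \<open>adj2 s (hd L)\<close> by (cases L) (auto simp: P_def)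
    moreover have "sublist [s, hd L] P" using sublist_join[of "[s]" L] L'(1) by (simp add: P_def)
    moreover have "sublist L P" by (simp add: P_def sublist_Cons_right)
    then have "sublist [t, b] P \<or> sublist [b, t] P"
      using b(2) sublist_order.order_trans by blast
    \<comment> \<open>The edge at \<open>t\<close> lies within \<open>W\<close>, so it cannot be the
      edge at \<open>s\<close>.\<close>
    moreover have "{t, b} \<noteq> {s, hd L}" using \<open>b \<in> W\<close> \<open>s \<notin> W\<close> d by (auto simp: doubleton_eq_iff)
    ultimately show ?thesis using L'(4) b(1) by blast
  qed
  have ham: "hamiltonian_path (square G) (hd P) (zip P (tl P)) (last P)"
    if "P \<noteq> []" "distinct P" "set P = pverts G" "successively adj2 P" for P
  proof (rule hamiltonian_path_of_list)
    have "successively (\<lambda>x y. x \<in> set P \<and> y \<in> set P \<and> x \<noteq> y \<and> adj2 x y) P"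
      using that(2,4) by (simp add: successively_conv_nth nth_eq_iff_index_eq)
    then show "successively (\<lambda>x y. (x, y) \<in> parcs (square G)) P"
      by (rule successively_mono)
        (use that(3) graph_dist_le_2[OF assms(1)] in \<open>auto simp: square_def adj2_def\<close>)
  qed (use that in \<open>simp_all add: square_def\<close>)
  show ?thesis
    unfolding strong_F3_def
  proof (intro allI impI ballI)
    fix x :: "nat \<Rightarrow> 'a" and i :: nat
    assume x: "x ` {1, 2, 3} \<subseteq> pverts G \<and> inj_on x {1, 2, 3}" and i: "i \<in> {1, 2}"
    have V: "x 1 \<in> pverts G" "x 2 \<in> pverts G" "x 3 \<in> pverts G"
      and d: "x 1 \<noteq> x 2" "x 1 \<noteq> x 3" "x 2 \<noteq> x 3"
      using x by (auto simp: inj_on_def)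
    have "\<exists>P b c. P \<noteq> [] \<and> distinct P \<and> set P = pverts G \<and> successively adj2 P \<and> hd P = x 1 \<and>
        last P = x 2 \<and> (x 3, b) \<in> parcs G \<and> (x i, c) \<in> parcs G \<and> {x 3, b} \<noteq> {x i, c} \<and>
        (sublist [x 3, b] P \<or> sublist [b, x 3] P) \<and> (sublist [x i, c] P \<or> sublist [c, x i] P)"
    proof (cases "i = 1")
      case True
      then show ?thesis using main[of "x 1" "x 2" "x 3"] V d by blast
    next
      case False
      \<comment> \<open>Here the list is built from \<open>x 2\<close> to \<open>x 1\<close> and
        then reversed.\<close>
      then have "i = 2" using i by simp
      obtain P b c where P: "P \<noteq> []" "distinct P" "set P = pverts G" "successively adj2 P"
        "hd P = x 2" "last P = x 1" "(x 3, b) \<in> parcs G" "(x 2, c) \<in> parcs G" "{x 3, b} \<noteq> {x 2, c}"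
        "sublist [x 3, b] P \<or> sublist [b, x 3] P" "sublist [x 2, c] P"
        using main[of "x 2" "x 1" "x 3"] V d by metis
      have "(\<lambda>x y. adj2 y x) = adj2" using adj2_sym by blast
      then have "successively adj2 (rev P)" using P(4) by (simp only: successively_rev)
      moreover have "sublist [b, x 3] (rev P) \<or> sublist [x 3, b] (rev P)" "sublist [c, x 2] (rev P)"
        using P(10,11) sublist_rev[of "[x 3, b]" P] sublist_rev[of "[b, x 3]" P]
          sublist_rev[of "[x 2, c]" P] by auto
      ultimately show ?thesis
        using P(1-3,5-9) \<open>i = 2\<close>
        by (intro exI[of _ "rev P"] exI[of _ b] exI[of _ c]) (auto simp: hd_rev last_rev simp del: successively_rev)
    qed
    then obtain P b c where P: "P \<noteq> []" "distinct P" "set P = pverts G" "successively adj2 P"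
      "hd P = x 1" "last P = x 2" "(x 3, b) \<in> parcs G" "(x i, c) \<in> parcs G" "{x 3, b} \<noteq> {x i, c}"
      "sublist [x 3, b] P \<or> sublist [b, x 3] P" "sublist [x i, c] P \<or> sublist [c, x i] P"
      by metis
    have "hamiltonian_path (square G) (x 1) (zip P (tl P)) (x 2)"
      using ham[OF P(1-4)] P(5,6) by simp
    then show "\<exists>p z3 zi. hamiltonian_path (square G) (x 1) p (x 2) \<and> (x 3, z3) \<in> parcs G \<and>
        (x i, zi) \<in> parcs G \<and> {x 3, z3} \<noteq> {x i, zi} \<and> {x 3, z3} \<in> path_edges p \<and> {x i, zi} \<in> path_edges p"
      using P(7-9) path_edges_of_sublist[OF P(10)] path_edges_of_sublist[OF P(11)] by blast
  qed
qed

end
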